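(* Let $1\le p<\infty$. Assume that $X$ supports a global $1$-Poincaré inequality and that $\mu$ has the global $1$-annular decay property. Then there is a constant $C\ge1$, independent of $x_0$, $r$ and $R$, such that $$\frac1C\Bigl(1-\frac{r}{R}\Bigr)^{1-p}\frac{\mu(B_R)}{R^p}\le\operatorname{cap}_p(B_r,B_R)\le C\Bigl(1-\frac{r}{R}\Bigr)^{1-p}\frac{\mu(B_R)}{R^p}\qquad\text{whenever } 0<\frac R2\le r<R\le\frac{\operatorname{diam}X}{3}.$$
   Context: $X=(X,d,\mu)$ is a metric space equipped with a metric $d$ and a positive complete Borel measure $\mu$ such that $0<\mu(B)<\infty$ for all balls $B\subset X$. Write $B(x,r)=\{y\in X: d(y,x)<r\}$; $x_0\in X$ is an arbitrary point and $B_r=B(x_0,r)$. For a ball $B=B(x,r)$ and $\lambda>0$, $\lambda B=B(x,\lambda r)$. Annular decay: $\mu$ has the global $1$-annular decay property if there is a constant $C$ such that $\mu(B(x,R)\setminus B(x,r))\le C(1-r/R)\mu(B(x,R))$ for all $x\in X$ and all radii $0<r<R$. Upper gradients and Newtonian space: curves are nonconstant, compact and rectifiable, parameterized by arc length $ds$. A Borel function $g:X\to[0,\infty]$ is an upper gradient of $f:X\to[-\infty,\infty]$ if for all curves $\gamma:[0,l_\gamma]\to X$, $|f(\gamma(0))-f(\gamma(l_\gamma))|\le\int_\gamma g\,ds$, where the left-hand side is considered to be $\infty$ whenever at least one of the terms therein is infinite. A measurable $g:X\to[0,\infty]$ is a $p$-weak upper gradient of $f$ if this inequality holds for $p$-almost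 every curve, i.e. except for a family $\Gamma$ of curves for which there is $0\le\rho\in L^p(X)$ with $\int_\gamma\rho\,ds=\infty$ for all $\gamma\in\Gamma$. If $f$ has an upper gradient in $L^p(X)$, then $g_f$ denotes its (a.e. unique) minimal $p$-weak upper gradient in $L^p(X)$, i.e. $g_f\le g$ a.e. for every $p$-weak upper gradient $g\in L^p(X)$ of $f$. $N^{1,p}(X)$ is the space of measurable functions $f:X\to[-\infty,\infty]$ (defined everywhere) with $\|f\|_{N^{1,p}(X)}=\bigl(\int_X|f|^p\,d\mu+\inf_g\int_X g^p\,d\mu\bigr)^{1/p}<\infty$, the infimum being over all upper gradients $g$ of $f$. Poincaré inequality: $X$ supports a global $1$-Poincaré inequality if there are constants $C>0$ and $\lambda\ge1$ such that for all balls $B=B(x,r)$, $x\in X$, all integrable functions $f$ on $X$ and all upper gradients $g$ of $f$, $\frac1{\mu(B)}\int_B|f-f_B|\,d\mu\le Cr\,\frac1{\mu(\lambda B)}\int_{\lambda B}g\,d\mu$, where $f_B=\frac1{\mu(B)}\int_Bf\,d\mu$. Variational capacity: for $\Omega\subset X$ open and $E\subset\Omega$, $\operatorname{cap}_p(E,\Omega)=\inf_u\int_\Omega g_u^p\,d\mu$, the infimum being over all $u\in N^{1,p}(X)$ with $\chi_E\le u\le1$ in $\Omega$ and $u=0$ on $X\setminus\Omega$. *)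

theory Defs
  imports "HOL-Analysis.Analysis"
begin

text \<open>The metric space $X$ is the whole type \<^typ>\<open>'a\<close> of class \<^class>\<open>metric_space\<close>, and the
  measure on it is \<open>M\<close>.\<close>

text \<open>A complete Borel measure is one whose sigma-algebra is the completion of the Borel
  sigma-algebra.\<close>

definition metric_measure_space :: "'a::metric_space measure \<Rightarrow> bool" where
  "metric_measure_space M \<longleftrightarrow>
     (\<exists>N. sets N = sets borel \<and> M = completion N) \<and>
     (\<forall>x r. 0 < r \<longrightarrow> 0 < emeasure M (ball x r) \<and> emeasure M (ball x r) < \<infinity>)"

text \<open>The library's \<^const>\<open>diameter\<close> is real-valued and hence unspecified on unbounded sets.\<close>

definition ediam :: "'a::metric_space set \<Rightarrow> ennreal" where
  "ediam S = (SUP (x, y) \<in> S \<times> S. ennreal (dist x y))"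

text \<open>Powers of extended nonnegative reals; only used for exponents \<open>p > 0\<close>.\<close>

definition enn_powr :: "ennreal \<Rightarrow> real \<Rightarrow> ennreal" where
  "enn_powr a p = (if a = \<infinity> then \<infinity> else ennreal (enn2real a powr p))"

definition annular_decay_1 :: "'a::metric_space measure \<Rightarrow> bool" where
  "annular_decay_1 M \<longleftrightarrow>
     (\<exists>C. \<forall>x r R. 0 < r \<and> r < R \<longrightarrow>
        measure M (ball x R - ball x r) \<le> C * (1 - r / R) * measure M (ball x R))"


subsection \<open>Curves and line integrals\<close>

definition curve_length :: "(real \<Rightarrow> 'a::metric_space) \<Rightarrow> real \<Rightarrow> real \<Rightarrow> ennreal" where
  "curve_length \<gamma> a b =
     (SUP (n, t) \<in> {(n::nat, t). t 0 = a \<and> t n = b \<and> (\<forall>i<n. t i \<le> t (Suc i))}.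
        \<Sum>i<n. ennreal (dist (\<gamma> (t i)) (\<gamma> (t (Suc i)))))"

text \<open>A nonconstant compact rectifiable curve of length \<open>l\<close>, parameterized by arc length on
  \<open>{0..l}\<close>; the values of \<open>\<gamma>\<close> outside this interval are irrelevant.\<close>

definition arc_length_curve :: "(real \<Rightarrow> 'a::metric_space) \<Rightarrow> real \<Rightarrow> bool" where
  "arc_length_curve \<gamma> l \<longleftrightarrow>
     0 < l \<and> continuous_on {0..l} \<gamma> \<and> (\<forall>t\<in>{0..l}. curve_length \<gamma> 0 t = ennreal t)"

text \<open>For non-measurable integrands the library's nonnegative integral is the lower integral.
  If \<open>g\<close> is measurable with respect to the completed Borel sigma-algebra, then \<open>g \<circ> \<gamma>\<close> is
  Lebesgue measurable for \<open>p\<close>-almost every curve \<open>\<gamma>\<close>.\<close>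

definition line_integral :: "('a::metric_space \<Rightarrow> ennreal) \<Rightarrow> (real \<Rightarrow> 'a) \<Rightarrow> real \<Rightarrow> ennreal" where
  "line_integral g \<gamma> l = (\<integral>\<^sup>+t\<in>{0..l}. g (\<gamma> t) \<partial>lebesgue)"


subsection \<open>Upper gradients\<close>

definition ext_dist :: "ereal \<Rightarrow> ereal \<Rightarrow> ennreal" where
  "ext_dist a b = (if \<bar>a\<bar> = \<infinity> \<or> \<bar>b\<bar> = \<infinity> then \<infinity> else e2ennreal \<bar>a - b\<bar>)"

definition upper_gradient :: "('a::metric_space \<Rightarrow> ereal) \<Rightarrow> ('a \<Rightarrow> ennreal) \<Rightarrow> bool" where
  "upper_gradient f g \<longleftrightarrow>
     g \<in> borel_measurable borel \<and>
     (\<forall>\<gamma> l. arc_length_curve \<gamma> l \<longrightarrow> ext_dist (f (\<gamma> 0)) (f (\<gamma> l)) \<le> line_integral g \<gamma> l)"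

definition Lp_nonneg :: "'a measure \<Rightarrow> real \<Rightarrow> ('a \<Rightarrow> ennreal) set" where
  "Lp_nonneg M p = {g \<in> borel_measurable M. (\<integral>\<^sup>+x. enn_powr (g x) p \<partial>M) < \<infinity>}"

text \<open>A curve family is given as a set of pairs of an arc-length parameterization and a length.\<close>

definition p_exceptional ::
    "'a::metric_space measure \<Rightarrow> real \<Rightarrow> ((real \<Rightarrow> 'a) \<times> real) set \<Rightarrow> bool" where
  "p_exceptional M p \<Gamma> \<longleftrightarrow>
     (\<exists>\<rho>\<in>Lp_nonneg M p. \<forall>(\<gamma>, l)\<in>\<Gamma>. line_integral \<rho> \<gamma> l = \<infinity>)"

definition weak_upper_gradient ::
    "'a::metric_space measure \<Rightarrow> real \<Rightarrow> ('a \<Rightarrow> ereal) \<Rightarrow> ('a \<Rightarrow> ennreal) \<Rightarrow> bool" where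
  "weak_upper_gradient M p f g \<longleftrightarrow>
     g \<in> borel_measurable M \<and>
     p_exceptional M p {(\<gamma>, l). arc_length_curve \<gamma> l \<and>
       \<not> ext_dist (f (\<gamma> 0)) (f (\<gamma> l)) \<le> line_integral g \<gamma> l}"

definition is_minimal_weak_upper_gradient ::
    "'a::metric_space measure \<Rightarrow> real \<Rightarrow> ('a \<Rightarrow> ereal) \<Rightarrow> ('a \<Rightarrow> ennreal) \<Rightarrow> bool" where
  "is_minimal_weak_upper_gradient M p f g \<longleftrightarrow>
     g \<in> Lp_nonneg M p \<and> weak_upper_gradient M p f g \<and>
     (\<forall>h\<in>Lp_nonneg M p. weak_upper_gradient M p f h \<longrightarrow> (AE x in M. g x \<le> h x))"

text \<open>A representative of the a.e. unique minimal \<open>p\<close>-weak upper gradient; meaningful if \<open>f\<close> has an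
  upper gradient in $L^p$.\<close>

definition minimal_weak_upper_gradient ::
    "'a::metric_space measure \<Rightarrow> real \<Rightarrow> ('a \<Rightarrow> ereal) \<Rightarrow> 'a \<Rightarrow> ennreal" where
  "minimal_weak_upper_gradient M p f = (SOME g. is_minimal_weak_upper_gradient M p f g)"


subsection \<open>Newtonian space, Poincare inequality, capacity\<close>

definition newtonian_norm ::
    "'a::metric_space measure \<Rightarrow> real \<Rightarrow> ('a \<Rightarrow> ereal) \<Rightarrow> ennreal" where
  "newtonian_norm M p f =
     enn_powr ((\<integral>\<^sup>+x. enn_powr (e2ennreal \<bar>f x\<bar>) p \<partial>M) +
               (INF g \<in> {g. upper_gradient f g}. \<integral>\<^sup>+x. enn_powr (g x) p \<partial>M)) (1 / p)"

definition newtonian_space :: "'a::metric_space measure \<Rightarrow> real \<Rightarrow> ('a \<Rightarrow> ereal) set" where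
  "newtonian_space M p = {f \<in> borel_measurable M. newtonian_norm M p f < \<infinity>}"

text \<open>Integrable functions may take the values \<open>\<plusminus>\<infinity>\<close> on a null set, on which the conversion
  \<^const>\<open>real_of_ereal\<close> in the mean value is immaterial.\<close>

definition mean_value :: "'a measure \<Rightarrow> 'a set \<Rightarrow> ('a \<Rightarrow> ereal) \<Rightarrow> real" where
  "mean_value M B f = (LINT x:B|M. real_of_ereal (f x)) / measure M B"

definition poincare_1 :: "'a::metric_space measure \<Rightarrow> bool" where
  "poincare_1 M \<longleftrightarrow>
     (\<exists>C::real. \<exists>\<Lambda>::real. C > 0 \<and> \<Lambda> \<ge> 1 \<and>
       (\<forall>x r f g. 0 < r \<longrightarrow> f \<in> borel_measurable M \<longrightarrow> (\<integral>\<^sup>+y. e2ennreal \<bar>f y\<bar> \<partial>M) < \<infinity> \<longrightarrow>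
          upper_gradient f g \<longrightarrow>
          (\<integral>\<^sup>+y\<in>ball x r. e2ennreal \<bar>f y - ereal (mean_value M (ball x r) f)\<bar> \<partial>M)
              / emeasure M (ball x r)
            \<le> ennreal (C * r) *
              ((\<integral>\<^sup>+y\<in>ball x (\<Lambda> * r). g y \<partial>M) / emeasure M (ball x (\<Lambda> * r)))))"

definition var_cap ::
    "'a::metric_space measure \<Rightarrow> real \<Rightarrow> 'a set \<Rightarrow> 'a set \<Rightarrow> ennreal" where
  "var_cap M p E \<Omega> =
     (INF u \<in> {u \<in> newtonian_space M p.
                (\<forall>x\<in>\<Omega>. indicator E x \<le> u x \<and> u x \<le> 1) \<and> (\<forall>x. x \<notin> \<Omega> \<longrightarrow> u x = 0)}.
        \<integral>\<^sup>+x\<in>\<Omega>. enn_powr (minimal_weak_upper_gradient M p u x) p \<partial>M)"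

end

theory Submission
  imports Defs
begin

text \<open>The upper bound tests the capacity with the radial cutoff function, whose upper gradient is
  \<open>1 / (R - r)\<close> on the annulus, and estimates the measure of the annulus by annular decay. For the
  lower bound, an admissible \<open>u\<close> is \<open>1\<close> on \<open>B\<^sub>r\<close> and \<open>0\<close> on a ball of radius \<open>R / 5\<close> inside
  \<open>2B\<^sub>R - B\<^sub>R\<close>; annular decay implies doubling, so both balls fill a fixed portion of \<open>2B\<^sub>R\<close> and the
  Poincare inequality gives \<open>\<mu>(B\<^sub>R) / R\<close> as a lower bound for the integral of \<open>g\<^sub>u\<close>, which lives on the
  annulus. Hoelder's inequality on the annulus turns this into a bound for the integral of \<open>g\<^sub>u\<^sup>p\<close>.

  The minimal weak upper gradient is the limit of a decreasing minimizing sequence; the essential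
  point is that the minimum of two weak upper gradients is again one.\<close>

subsection \<open>Powers of extended nonnegative reals\<close>

text \<open>Both bounds use the same estimate of the annulus, by \<open>A * (1 - r / R)\<close>
  times the measure of \<open>B_R\<close>. In the upper bound it multiplies
  \<open>(1 / (R - r)) powr p\<close>; in the lower bound it enters Hoelder's inequality with the
  exponent \<open>1 - p \<le> 0\<close>. Both times \<open>(1 - r / R) powr (1 - p)\<close> is what
  remains. \<open>var_cap\<close> speaks of a minimal weak upper gradient picked by
  \<open>SOME\<close>, so existence has to be proved before the capacity can be estimated at all.
  Closure under minima makes a minimizing sequence monotone, and monotone convergence along each
  good curve then identifies its limit as a weak upper gradient, for all \<open>p\<close> alike.
  Minima, and setting a gradient to zero where the function is constant, both rest on bounds over
  all subintervals of a curve; these are available because almost every curve has only good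
  subcurves. The diameter bound yields only a point far from \<open>x0\<close>, possibly much too
  far; the Poincare inequality, used as a form of connectedness, supplies one at a distance
  comparable to \<open>R\<close>.\<close>

lemma enn_powr_mono:
  assumes "0 \<le> p" "a \<le> b"
  shows "enn_powr a p \<le> enn_powr b p"
proof (cases "b = \<infinity>")
  case False
  then have "enn2real a \<le> enn2real b"
    using assms by (intro enn2real_mono) (auto simp: less_top)
  moreover have "a \<noteq> \<infinity>" using False assms by (auto simp: top_unique)
  ultimately show ?thesis using False assms
    by (auto simp: enn_powr_def intro!: ennreal_leI powr_mono2)
qed (simp add: enn_powr_def)

lemma enn_powr_ennreal: "0 \<le> a \<Longrightarrow> enn_powr (ennreal a) p = ennreal (a powr p)"
  by (simp add: enn_powr_def)

lemma enn_powr_0: "enn_powr 0 p = 0"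
  by (simp add: enn_powr_def)

lemma enn_powr_eq_top: "enn_powr a p = \<infinity> \<longleftrightarrow> a = \<infinity>"
  by (simp add: enn_powr_def)

lemma enn_powr_less_top: "enn_powr a p < \<infinity> \<longleftrightarrow> a < \<infinity>"
  unfolding infinity_ennreal_def less_top[symmetric] using enn_powr_eq_top[of a p] by simp

lemma enn_powr_powr:
  assumes "0 < p" "0 < q" "p * q = 1"
  shows "enn_powr (enn_powr a p) q = a"
  using assms by (cases a) (auto simp: enn_powr_def powr_powr)

lemma enn_powr_cmult:
  assumes "0 < c" "0 < p"
  shows "enn_powr (ennreal c * a) p = ennreal (c powr p) * enn_powr a p"
proof (cases a)
  case (real r)
  then have "enn_powr (ennreal c * a) p = enn_powr (ennreal (c * r)) p"
    using assms by (simp add: ennreal_mult)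
  also have "\<dots> = ennreal (c powr p * r powr p)"
    using real assms by (subst enn_powr_ennreal) (auto simp: powr_mult)
  also have "\<dots> = ennreal (c powr p) * enn_powr a p"
    using real by (simp add: enn_powr_ennreal ennreal_mult)
  finally show ?thesis .
next
  case top
  then show ?thesis using assms by (simp add: enn_powr_def ennreal_mult_top)
qed

lemma borel_measurable_enn_powr[measurable]:
  "(\<lambda>a. enn_powr a p) \<in> borel_measurable borel"
  unfolding enn_powr_def by measurable

text \<open>Each \<open>a n\<close> is at most the \<open>p\<close>-th root of the sum. Countably
  many densities are later combined by a supremum because its \<open>p\<close>-th power can be
  estimated termwise in this way.\<close>

lemma enn_powr_SUP_le:
  assumes p: "0 < p"
  shows "enn_powr (SUP n. a n) p \<le> (\<Sum>n. enn_powr (a n) p)"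
proof -
  let ?s = "\<Sum>n. enn_powr (a n) p"
  have "a n \<le> enn_powr ?s (1/p)" for n
  proof -
    have "enn_powr (a n) p \<le> ?s"
      using sum_le_suminf[OF summableI, of "{n}" "\<lambda>n. enn_powr (a n) p"] by simp
    then have "enn_powr (enn_powr (a n) p) (1/p) \<le> enn_powr ?s (1/p)"
      using p by (intro enn_powr_mono) auto
    then show ?thesis using p by (simp add: enn_powr_powr)
  qed
  then have "(SUP n. a n) \<le> enn_powr ?s (1/p)" by (intro SUP_least)
  then have "enn_powr (SUP n. a n) p \<le> enn_powr (enn_powr ?s (1/p)) p"
    using p by (intro enn_powr_mono) auto
  then show ?thesis using p by (simp add: enn_powr_powr)
qed

text \<open>Below 1 the constant dominates, above 1 the power does. It shows that functions in
  \<open>L^p\<close> are integrable on balls.\<close>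

lemma le_one_plus_enn_powr:
  assumes p: "1 \<le> p"
  shows "a \<le> 1 + enn_powr a p"
proof (cases a)
  case (real r)
  have "r \<le> 1 + r powr p"
  proof (cases "r \<le> 1")
    case True then show ?thesis by (smt (verit) powr_ge_zero)
  next
    case False
    then have "r powr 1 \<le> r powr p" using p by (intro powr_mono) auto
    then show ?thesis using False by simp
  qed
  then have "ennreal r \<le> ennreal (1 + r powr p)" by (rule ennreal_leI)
  then show ?thesis using real by (simp add: enn_powr_ennreal)
qed (simp add: enn_powr_def)

text \<open>Convexity: the tangent of \<open>a powr p\<close> at \<open>a = s\<close> lies below the
  graph, with its constant term moved to the right. Young's inequality with the exponents
  \<open>p\<close> and \<open>p / (p - 1)\<close> gives it for \<open>p > 1\<close>; for
  \<open>p = 1\<close> both sides equal \<open>a\<close>.\<close>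

lemma young_tangent:
  fixes a s p :: real
  assumes "0 \<le> a" "0 < s" "1 \<le> p"
  shows "p * s powr (p - 1) * a \<le> a powr p + (p - 1) * s powr p"
proof (cases "p = 1")
  case False
  then have p: "p > 1" using assms by simp
  have "a * s powr (p - 1) \<le> a powr p / p + (s powr (p - 1)) powr (p / (p - 1)) / (p / (p - 1))"
    using p assms by (intro Youngs_inequality) (auto simp: field_simps)
  also have "(s powr (p - 1)) powr (p / (p - 1)) = s powr p"
    using p by (simp add: powr_powr)
  finally show ?thesis using p by (simp add: field_simps)
qed (use assms in auto)

subsection \<open>The Borel sigma-algebra and its completion\<close>

lemma mms_completion:
  assumes "metric_measure_space M"
  obtains N where "sets N = sets borel" "space N = UNIV" "M = completion N"
proof -
  obtain N where N: "sets N = sets borel" "M = completion N"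
    using assms unfolding metric_measure_space_def by blast
  then show ?thesis using that[of N] sets_eq_imp_space_eq[OF N(1)] by simp
qed

lemma mms_borel_sets: "metric_measure_space M \<Longrightarrow> sets borel \<subseteq> sets M"
  by (erule mms_completion) (metis sets_completionI_sets subsetI)

lemma mms_borel_measurable:
  assumes "metric_measure_space M" "f \<in> borel_measurable borel"
  shows "f \<in> borel_measurable M"
proof -
  obtain N where N: "sets N = sets borel" "M = completion N"
    using mms_completion[OF assms(1)] by metis
  have "f \<in> borel_measurable N"
    using assms(2) measurable_cong_sets[OF N(1) refl] by blast
  then show ?thesis unfolding N(2) by (rule measurable_completion)
qed

lemma mms_ball: "metric_measure_space M \<Longrightarrow> ball x r \<in> sets M"
  using mms_borel_sets[of M] by auto

text \<open>An a.e. equal Borel function would not do: a null set can contain whole curves, and line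
  integrals must not decrease under the replacement. Hence a majorant at every point.\<close>

lemma borel_majorant:
  fixes h :: "'a::metric_space \<Rightarrow> ennreal"
  assumes "metric_measure_space M" and h: "h \<in> borel_measurable M"
  obtains h' where "h' \<in> borel_measurable borel" "\<And>x. h x \<le> h' x" "AE x in M. h' x = h x"
proof -
  obtain N where N: "sets N = sets borel" "space N = UNIV" "M = completion N"
    using mms_completion[OF assms(1)] by metis
  obtain g where g: "g \<in> borel_measurable N" "AE x in N. h x = g x"
    using completion_ex_borel_measurable[of h N] h N by auto
  obtain Z where Z: "{x \<in> space N. h x \<noteq> g x} \<subseteq> Z" "emeasure N Z = 0" "Z \<in> sets N"
    using g(2) by (auto elim!: AE_E)
  \<comment> \<open>The value infinity on a Borel null set containing all discrepancies keeps
    \<open>h'\<close> above \<open>h\<close> there.\<close>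
  define h' where "h' x = (if x \<in> Z then \<infinity> else g x)" for x
  have "h' \<in> borel_measurable N" unfolding h'_def using Z g by measurable
  then have "h' \<in> borel_measurable borel" using measurable_cong_sets[OF N(1) refl] by blast
  moreover have "h x \<le> h' x" for x
  proof (cases "x \<in> Z")
    case False
    then have "h x = g x" using Z(1) N(2) by blast
    then show ?thesis using False by (simp add: h'_def)
  qed (simp add: h'_def)
  moreover have "AE x in N. x \<notin> Z" using Z by (intro AE_not_in) (auto simp: null_sets_def)
  then have "AE x in N. h' x = h x" using g(2) by eventually_elim (auto simp: h'_def)
  then have "AE x in M. h' x = h x" unfolding N(3) by (rule AE_completion)
  ultimately show ?thesis using that by blast
qed

subsection \<open>Exceptional curve families\<close>

lemma line_integral_mono:
  assumes "\<And>x. g x \<le> h x"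
  shows "line_integral g \<gamma> l \<le> line_integral h \<gamma> l"
  unfolding line_integral_def using assms by (intro nn_integral_mono mult_right_mono) auto

lemma p_exceptionalI:
  assumes "metric_measure_space M" "\<rho> \<in> borel_measurable borel"
    "(\<integral>\<^sup>+x. enn_powr (\<rho> x) p \<partial>M) < \<infinity>"
    "\<And>\<gamma> l. (\<gamma>, l) \<in> \<Gamma> \<Longrightarrow> line_integral \<rho> \<gamma> l = \<infinity>"
  shows "p_exceptional M p \<Gamma>"
  using assms mms_borel_measurable unfolding p_exceptional_def Lp_nonneg_def by fastforce

text \<open>The density may be taken Borel, since line integrals that are infinite stay so for a
  majorant; composition with a curve is then measurable.\<close>

lemma p_exceptionalE:
  assumes "metric_measure_space M" "p_exceptional M p \<Gamma>"
  obtains \<rho> where "\<rho> \<in> borel_measurable borel" "(\<integral>\<^sup>+x. enn_powr (\<rho> x) p \<partial>M) < \<infinity>"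
    "\<And>\<gamma> l. (\<gamma>, l) \<in> \<Gamma> \<Longrightarrow> line_integral \<rho> \<gamma> l = \<infinity>"
proof -
  obtain \<rho> where r: "\<rho> \<in> borel_measurable M" "(\<integral>\<^sup>+x. enn_powr (\<rho> x) p \<partial>M) < \<infinity>"
    "\<forall>(\<gamma>, l)\<in>\<Gamma>. line_integral \<rho> \<gamma> l = \<infinity>"
    using assms(2) by (auto simp: p_exceptional_def Lp_nonneg_def)
  obtain h where h: "h \<in> borel_measurable borel" "\<And>x. \<rho> x \<le> h x" "AE x in M. h x = \<rho> x"
    using borel_majorant[OF assms(1) r(1)] by blast
  have "(\<integral>\<^sup>+x. enn_powr (h x) p \<partial>M) = (\<integral>\<^sup>+x. enn_powr (\<rho> x) p \<partial>M)"
    by (intro nn_integral_cong_AE) (use h(3) in eventually_elim, simp)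
  moreover have "line_integral h \<gamma> l = \<infinity>" if "(\<gamma>, l) \<in> \<Gamma>" for \<gamma> l
    using line_integral_mono[of \<rho> h \<gamma> l, OF h(2)] r(3) that by (auto simp: top_unique)
  ultimately show ?thesis using that h(1) r(2) by metis
qed

lemma p_exceptional_subset:
  "p_exceptional M p \<Gamma> \<Longrightarrow> \<Delta> \<subseteq> \<Gamma> \<Longrightarrow> p_exceptional M p \<Delta>"
  unfolding p_exceptional_def by blast

lemma measurable_along_curve:
  fixes \<gamma> :: "real \<Rightarrow> 'a::metric_space" and g :: "'a \<Rightarrow> ennreal"
  assumes "continuous_on {0..l} \<gamma>" "g \<in> borel_measurable borel" "0 \<le> a" "b \<le> l"
  shows "(\<lambda>t. g (\<gamma> t) * indicator {a..b} t) \<in> borel_measurable borel"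
proof -
  have "continuous_on {a..b} \<gamma>" using assms by (auto intro: continuous_on_subset)
  then have "\<gamma> \<in> borel_measurable (restrict_space borel {a..b})"
    by (rule borel_measurable_continuous_on_restrict)
  then have "(\<lambda>t. g (\<gamma> t)) \<in> borel_measurable (restrict_space borel {a..b})"
    using assms(2) by (rule measurable_compose)
  then show ?thesis
    by (subst (asm) borel_measurable_restrict_space_iff_ennreal) auto
qed

lemma line_integral_lborel: "line_integral g \<gamma> l = (\<integral>\<^sup>+t\<in>{0..l}. g (\<gamma> t) \<partial>lborel)"
  unfolding line_integral_def by (rule nn_integral_completion)

lemma line_integral_cmult:
  assumes "arc_length_curve \<gamma> l" "g \<in> borel_measurable borel"
  shows "line_integral (\<lambda>x. c * g x) \<gamma> l = c * line_integral g \<gamma> l"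
  unfolding line_integral_lborel mult.assoc
  using measurable_along_curve[of l \<gamma> g 0 l] assms
  by (intro nn_integral_cmult) (auto simp: arc_length_curve_def)

text \<open>Countable unions of families of modulus zero. The densities are scaled so that the
  \<open>p\<close>-th power integral of the \<open>n\<close>-th one is at most
  \<open>(1/2)^n\<close>; their supremum then lies in \<open>L^p\<close> and still has infinite
  integral along every curve of every family.\<close>

lemma p_exceptional_UN:
  fixes \<Gamma> :: "nat \<Rightarrow> ((real \<Rightarrow> 'a::metric_space) \<times> real) set"
  assumes M: "metric_measure_space M" and p: "0 < p"
    and ex: "\<And>n. p_exceptional M p (\<Gamma> n)"
    and arc: "\<And>n \<gamma> l. (\<gamma>, l) \<in> \<Gamma> n \<Longrightarrow> arc_length_curve \<gamma> l"
  shows "p_exceptional M p (\<Union>n. \<Gamma> n)"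
proof -
  have "\<exists>\<rho>. \<rho> \<in> borel_measurable borel \<and> (\<integral>\<^sup>+x. enn_powr (\<rho> x) p \<partial>M) < \<infinity> \<and>
    (\<forall>\<gamma> l. (\<gamma>, l) \<in> \<Gamma> n \<longrightarrow> line_integral \<rho> \<gamma> l = \<infinity>)" for n
    using p_exceptionalE[OF M ex[of n]] by metis
  then obtain \<rho> where \<rho>: "\<And>n. \<rho> n \<in> borel_measurable borel"
    "\<And>n. (\<integral>\<^sup>+x. enn_powr (\<rho> n x) p \<partial>M) < \<infinity>"
    "\<And>n \<gamma> l. (\<gamma>, l) \<in> \<Gamma> n \<Longrightarrow> line_integral (\<rho> n) \<gamma> l = \<infinity>"
    by metis
  have [measurable]: "\<rho> n \<in> borel_measurable M" for n by (rule mms_borel_measurable[OF M \<rho>(1)])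
  define J where "J n = enn2real (\<integral>\<^sup>+x. enn_powr (\<rho> n x) p \<partial>M)" for n
  have J: "(\<integral>\<^sup>+x. enn_powr (\<rho> n x) p \<partial>M) = ennreal (J n)" "0 \<le> J n" for n
    using \<rho>(2)[of n] by (auto simp: J_def)
  \<comment> \<open>The summand 1 guards against \<open>J n = 0\<close>; the exponent
    \<open>1/p\<close> makes \<open>c n powr p * J n \<le> (1/2)^n\<close>.\<close>
  define c where "c n = ((1/2)^n / (1 + J n)) powr (1/p)" for n
  have c0: "c n > 0" for n using J(2)[of n] by (simp add: c_def add_pos_nonneg)
  have cp: "c n powr p = (1/2)^n / (1 + J n)" for n
    using J(2)[of n] p by (simp add: c_def powr_powr)
  define R where "R x = (SUP n. ennreal (c n) * \<rho> n x)" for x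
  have Rb: "R \<in> borel_measurable borel" unfolding R_def using \<rho>(1) by measurable
  have "(\<integral>\<^sup>+x. enn_powr (R x) p \<partial>M) \<le> (\<integral>\<^sup>+x. (\<Sum>n. enn_powr (ennreal (c n) * \<rho> n x) p) \<partial>M)"
    unfolding R_def by (intro nn_integral_mono enn_powr_SUP_le p)
  also have "\<dots> = (\<Sum>n. \<integral>\<^sup>+x. enn_powr (ennreal (c n) * \<rho> n x) p \<partial>M)"
    by (intro nn_integral_suminf) measurable
  also have "\<dots> = (\<Sum>n. ennreal (c n powr p) * ennreal (J n))"
    using c0 p by (simp add: enn_powr_cmult nn_integral_cmult J)
  also have "\<dots> \<le> (\<Sum>n. ennreal ((1/2)^n))"
  proof (intro suminf_le summableI)
    fix n
    have "c n powr p * J n \<le> (1/2)^n"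
      unfolding cp using J(2)[of n] by (simp add: divide_le_eq algebra_simps)
    then have "ennreal (c n powr p * J n) \<le> ennreal ((1/2)^n)" by (rule ennreal_leI)
    then show "ennreal (c n powr p) * ennreal (J n) \<le> ennreal ((1/2)^n)"
      by (subst ennreal_mult[symmetric]) (auto simp: J(2))
  qed
  also have "\<dots> < \<infinity>"
    unfolding infinity_ennreal_def less_top[symmetric]
    by (rule ennreal_suminf_neq_top) (auto intro: summable_geometric)
  finally have "(\<integral>\<^sup>+x. enn_powr (R x) p \<partial>M) < \<infinity>" .
  moreover have "line_integral R \<gamma> l = \<infinity>" if mem: "(\<gamma>, l) \<in> (\<Union>n. \<Gamma> n)" for \<gamma> l
  proof -
    obtain n where n: "(\<gamma>, l) \<in> \<Gamma> n" using mem by auto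
    have "ennreal (c n) * line_integral (\<rho> n) \<gamma> l = line_integral (\<lambda>x. ennreal (c n) * \<rho> n x) \<gamma> l"
      using arc[OF n] \<rho>(1) by (rule line_integral_cmult[symmetric])
    also have "\<dots> \<le> line_integral R \<gamma> l"
      unfolding R_def by (intro line_integral_mono SUP_upper) auto
    finally show ?thesis 
      unfolding \<rho>(3)[OF n] using c0[of n] by (auto simp: ennreal_mult_top top_unique)
  qed
  ultimately show ?thesis using p_exceptionalI[OF M Rb] by blast
qed

lemma p_exceptional_Un:
  assumes "metric_measure_space M" "0 < p" "p_exceptional M p \<Gamma>" "p_exceptional M p \<Delta>"
    "\<And>\<gamma> l. (\<gamma>, l) \<in> \<Gamma> \<union> \<Delta> \<Longrightarrow> arc_length_curve \<gamma> l"
  shows "p_exceptional M p (\<Gamma> \<union> \<Delta>)"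
proof -
  have "p_exceptional M p (\<Union>n::nat. if n = 0 then \<Gamma> else \<Delta>)"
    using assms by (intro p_exceptional_UN) (auto split: if_splits)
  moreover have "(\<Union>n::nat. if n = 0 then \<Gamma> else \<Delta>) = \<Gamma> \<union> \<Delta>"
    by (auto split: if_splits)
  ultimately show ?thesis by simp
qed

subsection \<open>Subcurves\<close>

lemma curve_length_le:
  assumes "\<And>n t. t 0 = a \<Longrightarrow> t n = b \<Longrightarrow> (\<And>i. i < n \<Longrightarrow> t i \<le> t (Suc i)) \<Longrightarrow>
    (\<Sum>i<n. ennreal (dist (\<gamma> (t i)) (\<gamma> (t (Suc i))))) \<le> L"
  shows "curve_length \<gamma> a b \<le> L"
  unfolding curve_length_def using assms by (intro SUP_least) auto

lemma le_curve_length: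
  assumes "t 0 = a" "t n = b" "\<And>i. i < n \<Longrightarrow> t i \<le> t (Suc i)"
  shows "(\<Sum>i<n. ennreal (dist (\<gamma> (t i)) (\<gamma> (t (Suc i))))) \<le> curve_length \<gamma> a b"
proof -
  have "(n, t) \<in> {(n::nat, t). t 0 = a \<and> t n = b \<and> (\<forall>i<n. t i \<le> t (Suc i))}"
    using assms by auto
  from SUP_upper[OF this, of "\<lambda>(n, t). \<Sum>i<n. ennreal (dist (\<gamma> (t i)) (\<gamma> (t (Suc i))))"]
  show ?thesis unfolding curve_length_def by simp
qed

lemma ennreal_SUP_add_le:
  fixes f :: "'a \<Rightarrow> ennreal" and g :: "'b \<Rightarrow> ennreal"
  assumes "A \<noteq> {}" "B \<noteq> {}" "\<And>x y. x \<in> A \<Longrightarrow> y \<in> B \<Longrightarrow> f x + g y \<le> L"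
  shows "(SUP x\<in>A. f x) + (SUP y\<in>B. g y) \<le> L"
proof -
  have *: "(SUP x\<in>A. f x) + g y \<le> L" if "y \<in> B" for y
    using assms(3) that
    by (subst ennreal_SUP_add_left[OF assms(1), symmetric]) (intro SUP_least, simp)
  show ?thesis
    unfolding add.commute[of "Sup (f ` A)"]
    by (subst ennreal_SUP_add_left[OF assms(2), symmetric])
      (intro SUP_least, use * in \<open>simp add: add.commute\<close>)
qed

text \<open>One inequality truncates a partition of \<open>{a..c}\<close> at \<open>b\<close>, the
  other concatenates partitions of the two halves.\<close>

lemma curve_length_add:
  assumes ab: "a \<le> b" and bc: "b \<le> c"
  shows "curve_length \<gamma> a c = curve_length \<gamma> a b + curve_length \<gamma> b c"
proof (rule antisym)
  show "curve_length \<gamma> a c \<le> curve_length \<gamma> a b + curve_length \<gamma> b c"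
  proof (rule curve_length_le)
    fix n and t :: "nat \<Rightarrow> real"
    assume t: "t 0 = a" "t n = c" "\<And>i. i < n \<Longrightarrow> t i \<le> t (Suc i)"
    \<comment> \<open>The truncations are again monotone and run from \<open>a\<close> to
      \<open>b\<close> and from \<open>b\<close> to \<open>c\<close>. Only for the step that jumps
      over \<open>b\<close> is the triangle inequality through \<open>\<gamma> b\<close>
      used.\<close>
    let ?u = "\<lambda>i. min (t i) b" and ?v = "\<lambda>i. max (t i) b"
    have "(\<Sum>i<n. ennreal (dist (\<gamma> (t i)) (\<gamma> (t (Suc i)))))
      \<le> (\<Sum>i<n. ennreal (dist (\<gamma> (?u i)) (\<gamma> (?u (Suc i)))) + ennreal (dist (\<gamma> (?v i)) (\<gamma> (?v (Suc i)))))"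
    proof (intro sum_mono)
      fix i assume "i \<in> {..<n}"
      then have "t i \<le> t (Suc i)" using t by auto
      then have "dist (\<gamma> (t i)) (\<gamma> (t (Suc i)))
        \<le> dist (\<gamma> (?u i)) (\<gamma> (?u (Suc i))) + dist (\<gamma> (?v i)) (\<gamma> (?v (Suc i)))"
        by (cases "t i \<le> b"; cases "t (Suc i) \<le> b")
          (auto simp: min_def max_def intro: dist_triangle)
      then show "ennreal (dist (\<gamma> (t i)) (\<gamma> (t (Suc i))))
        \<le> ennreal (dist (\<gamma> (?u i)) (\<gamma> (?u (Suc i)))) + ennreal (dist (\<gamma> (?v i)) (\<gamma> (?v (Suc i))))"
        by (simp add: ennreal_leI flip: ennreal_plus)
    qed
    also have "\<dots> = (\<Sum>i<n. ennreal (dist (\<gamma> (?u i)) (\<gamma> (?u (Suc i)))))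
        + (\<Sum>i<n. ennreal (dist (\<gamma> (?v i)) (\<gamma> (?v (Suc i)))))"
      by (rule sum.distrib)
    also have "\<dots> \<le> curve_length \<gamma> a b + curve_length \<gamma> b c"
      using t ab bc by (intro add_mono le_curve_length) (auto simp: min_def max_def, force+)
    finally show "(\<Sum>i<n. ennreal (dist (\<gamma> (t i)) (\<gamma> (t (Suc i)))))
      \<le> curve_length \<gamma> a b + curve_length \<gamma> b c" .
  qed
  let ?S = "\<lambda>n t. \<Sum>i<n. ennreal (dist (\<gamma> (t i)) (\<gamma> (t (Suc i))))"
  let ?P = "\<lambda>a b. {(n::nat, t). t 0 = a \<and> t n = b \<and> (\<forall>i<n. t i \<le> t (Suc i))}"
  have concat: "?S n t + ?S m s \<le> curve_length \<gamma> a c"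
    if nt: "(n, t) \<in> ?P a b" and ms: "(m, s) \<in> ?P b c" for n m t s
  proof -
    \<comment> \<open>The index \<open>n\<close> belongs to both pieces; they agree there because
      \<open>t n = b = s 0\<close>.\<close>
    define w where "w i = (if i \<le> n then t i else s (i - n))" for i
    have w1: "w i = t i" if "i \<le> n" for i using that by (simp add: w_def)
    have w2: "w (n + i) = s i" for i using nt ms by (cases i) (auto simp: w_def)
    have "?S n t + ?S m s = (\<Sum>i<n. ennreal (dist (\<gamma> (w i)) (\<gamma> (w (Suc i)))))
      + (\<Sum>i<m. ennreal (dist (\<gamma> (w (n + i))) (\<gamma> (w (n + Suc i)))))"
      unfolding w2 using w1 by simp
    also have "\<dots> = (\<Sum>i<n+m. ennreal (dist (\<gamma> (w i)) (\<gamma> (w (Suc i)))))"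
      by (induction m) (auto simp: add.assoc[symmetric])
    also have "\<dots> \<le> curve_length \<gamma> a c"
    proof (rule le_curve_length)
      show "w 0 = a" using nt w1 by auto
      show "w (n + m) = c" using ms w2 by auto
      fix i assume i: "i < n + m"
      show "w i \<le> w (Suc i)"
      proof (cases "i < n")
        case True then show ?thesis using nt w1 by auto
      next
        case False
        then obtain j where "i = n + j" using le_Suc_ex by (auto simp: not_less)
        then show ?thesis using w2[of j] w2[of "Suc j"] ms i by auto
      qed
    qed
    finally show ?thesis .
  qed
  have ne: "?P a b \<noteq> {}" "?P b c \<noteq> {}"
  proof -
    have "(1, \<lambda>i. if i = 0 then a else b) \<in> ?P a b" "(1, \<lambda>i. if i = 0 then b else c) \<in> ?P b c"
      using ab bc by auto
    then show "?P a b \<noteq> {}" "?P b c \<noteq> {}" by blast+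
  qed
  have "(SUP x\<in>?P a b. case x of (n, t) \<Rightarrow> ?S n t) + (SUP y\<in>?P b c. case y of (n, t) \<Rightarrow> ?S n t)
    \<le> curve_length \<gamma> a c"
    using concat by (intro ennreal_SUP_add_le ne) (auto split: prod.splits)
  then show "curve_length \<gamma> a b + curve_length \<gamma> b c \<le> curve_length \<gamma> a c"
    by (simp only: curve_length_def)
qed

lemma curve_length_shift: "curve_length (\<lambda>t. \<gamma> (a + t)) b c = curve_length \<gamma> (a + b) (a + c)"
proof (rule antisym)
  show "curve_length (\<lambda>t. \<gamma> (a + t)) b c \<le> curve_length \<gamma> (a + b) (a + c)"
    by (intro curve_length_le) (use le_curve_length[of "\<lambda>i. a + t i" "a + b" n "a + c" \<gamma> for t n] in simp)
  show "curve_length \<gamma> (a + b) (a + c) \<le> curve_length (\<lambda>t. \<gamma> (a + t)) b c"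
    by (intro curve_length_le)
      (use le_curve_length[of "\<lambda>i. t i - a" b n c "\<lambda>t. \<gamma> (a + t)" for t n] in simp)
qed

lemma curve_length_sub:
  assumes "arc_length_curve \<gamma> l" "0 \<le> a" "a \<le> b" "b \<le> l"
  shows "curve_length \<gamma> a b = ennreal (b - a)"
proof -
  have "curve_length \<gamma> 0 b = curve_length \<gamma> 0 a + curve_length \<gamma> a b"
    using assms by (intro curve_length_add) auto
  then have "ennreal a + curve_length \<gamma> a b = ennreal b"
    using assms by (simp add: arc_length_curve_def)
  also have "ennreal b = ennreal a + ennreal (b - a)"
    using assms by (simp flip: ennreal_plus)
  finally show ?thesis by simp
qed

lemma arc_length_curve_sub:
  assumes "arc_length_curve \<gamma> l" "0 \<le> a" "a < b" "b \<le> l"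
  shows "arc_length_curve (\<lambda>t. \<gamma> (a + t)) (b - a)"
  unfolding arc_length_curve_def
proof (intro conjI ballI)
  have c: "continuous_on {0..l} \<gamma>" using assms by (simp add: arc_length_curve_def)
  show "continuous_on {0..b - a} (\<lambda>t. \<gamma> (a + t))"
    by (rule continuous_on_compose2[OF c]) (use assms in \<open>auto intro!: continuous_intros\<close>)
  fix t assume t: "t \<in> {0..b - a}"
  then show "curve_length (\<lambda>t. \<gamma> (a + t)) 0 t = ennreal t"
    using curve_length_sub[OF assms(1,2), of "a + t"] assms by (simp add: curve_length_shift)
qed (use assms in simp)

lemma arc_length_curve_dist:
  assumes "arc_length_curve \<gamma> l" "0 \<le> a" "a \<le> b" "b \<le> l"
  shows "dist (\<gamma> a) (\<gamma> b) \<le> b - a"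
proof -
  have "ennreal (dist (\<gamma> a) (\<gamma> b)) \<le> curve_length \<gamma> a b"
    using le_curve_length[of "\<lambda>i. if i = 0 then a else b" a 1 b \<gamma>] assms by simp
  then show ?thesis using assms by (simp add: curve_length_sub)
qed

lemma line_integral_sub:
  fixes g :: "'a::metric_space \<Rightarrow> ennreal"
  assumes "arc_length_curve \<gamma> l" "g \<in> borel_measurable borel" "0 \<le> a" "a \<le> b" "b \<le> l"
  shows "line_integral g (\<lambda>t. \<gamma> (a + t)) (b - a) = (\<integral>\<^sup>+t\<in>{a..b}. g (\<gamma> t) \<partial>lborel)"
proof -
  have m: "(\<lambda>t. g (\<gamma> t) * indicator {a..b} t) \<in> borel_measurable borel"
    using measurable_along_curve[of l \<gamma> g a b] assms by (simp add: arc_length_curve_def)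
  have "(\<integral>\<^sup>+t\<in>{a..b}. g (\<gamma> t) \<partial>lborel)
    = (\<integral>\<^sup>+t. g (\<gamma> (a + t)) * indicator {a..b} (a + t) \<partial>lborel)"
    using nn_integral_real_affine[OF m, of 1 a] by simp
  also have "\<dots> = line_integral g (\<lambda>t. \<gamma> (a + t)) (b - a)"
    unfolding line_integral_lborel
    by (intro nn_integral_cong) (auto split: split_indicator)
  finally show ?thesis by simp
qed

text \<open>The density is nonnegative, so an infinite integral over a subcurve forces one over the
  whole curve. Consequently almost every curve satisfies a weak upper gradient inequality on all its
  subcurves at once.\<close>

lemma p_exceptional_super:
  fixes \<Gamma> :: "((real \<Rightarrow> 'a::metric_space) \<times> real) set"
  assumes M: "metric_measure_space M" and ex: "p_exceptional M p \<Gamma>"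
  shows "p_exceptional M p {(\<gamma>, l). arc_length_curve \<gamma> l \<and>
    (\<exists>a b. 0 \<le> a \<and> a < b \<and> b \<le> l \<and> ((\<lambda>t. \<gamma> (a + t)), b - a) \<in> \<Gamma>)}"
proof -
  obtain \<rho> where \<rho>: "\<rho> \<in> borel_measurable borel" "(\<integral>\<^sup>+x. enn_powr (\<rho> x) p \<partial>M) < \<infinity>"
    "\<And>\<gamma> l. (\<gamma>, l) \<in> \<Gamma> \<Longrightarrow> line_integral \<rho> \<gamma> l = \<infinity>"
    using p_exceptionalE[OF M ex] by metis
  show ?thesis
  proof (rule p_exceptionalI[OF M \<rho>(1,2)])
    fix \<gamma> :: "real \<Rightarrow> 'a" and l
    assume "(\<gamma>, l) \<in> {(\<gamma>, l). arc_length_curve \<gamma> l \<and>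
      (\<exists>a b. 0 \<le> a \<and> a < b \<and> b \<le> l \<and> ((\<lambda>t. \<gamma> (a + t)), b - a) \<in> \<Gamma>)}"
    then obtain a b where ab: "arc_length_curve \<gamma> l" "0 \<le> a" "a < b" "b \<le> l"
      "((\<lambda>t. \<gamma> (a + t)), b - a) \<in> \<Gamma>" by auto
    have "\<infinity> = (\<integral>\<^sup>+t\<in>{a..b}. \<rho> (\<gamma> t) \<partial>lborel)"
      using \<rho>(3)[OF ab(5)] line_integral_sub[OF ab(1) \<rho>(1), of a b] ab by simp
    also have "\<dots> \<le> line_integral \<rho> \<gamma> l"
      unfolding line_integral_lborel using ab
      by (intro nn_integral_mono) (auto split: split_indicator)
    finally show "line_integral \<rho> \<gamma> l = \<infinity>" by (simp add: top_unique)
  qed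
qed

subsection \<open>Functions along curves\<close>

text \<open>On each interval of a fine tagged division the tag decides which of the two bounds is used; by
  Henstock's lemma the resulting sum is close to the integral of the minimum.\<close>

lemma increment_le_integral_min:
  fixes h a b :: "real \<Rightarrow> real"
  assumes l: "0 \<le> l"
    and int: "a integrable_on {0..l}" "b integrable_on {0..l}" "(\<lambda>t. min (a t) (b t)) integrable_on {0..l}"
    and ha: "\<And>s t. 0 \<le> s \<Longrightarrow> s \<le> t \<Longrightarrow> t \<le> l \<Longrightarrow> \<bar>h t - h s\<bar> \<le> integral {s..t} a"
    and hb: "\<And>s t. 0 \<le> s \<Longrightarrow> s \<le> t \<Longrightarrow> t \<le> l \<Longrightarrow> \<bar>h t - h s\<bar> \<le> integral {s..t} b"
  shows "\<bar>h l - h 0\<bar> \<le> integral {0..l} (\<lambda>t. min (a t) (b t))"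
proof (rule field_le_epsilon)
  fix e :: real assume "e > 0"
  then have e: "e / 3 > 0" by simp
  let ?m = "\<lambda>t. min (a t) (b t)"
  have int': "a integrable_on cbox 0 l" "b integrable_on cbox 0 l" using int by simp_all
  \<comment> \<open>Different cells will use different bounds, so the errors must be small when
    summed in absolute value over cells; this is what Henstock's lemma gives. For the minimum itself
    the total Riemann sum suffices.\<close>
  obtain ga where ga: "gauge ga" "\<And>p. p tagged_partial_division_of (cbox 0 l) \<Longrightarrow> ga fine p \<Longrightarrow>
      sum (\<lambda>(x,k). norm (measure lborel k *\<^sub>R a x - integral k a)) p < e / 3"
    using Henstock_lemma[OF int'(1) e] by blast
  obtain gb where gb: "gauge gb" "\<And>p. p tagged_partial_division_of (cbox 0 l) \<Longrightarrow> gb fine p \<Longrightarrow>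
      sum (\<lambda>(x,k). norm (measure lborel k *\<^sub>R b x - integral k b)) p < e / 3"
    using Henstock_lemma[OF int'(2) e] by blast
  have mi: "(?m has_integral integral {0..l} ?m) (cbox 0 l)"
    using integrable_integral[OF int(3)] by simp
  from mi[unfolded has_integral, rule_format, OF e]
  obtain gm where gm: "gauge gm" "\<And>p. p tagged_division_of (cbox 0 l) \<Longrightarrow> gm fine p \<Longrightarrow>
      norm ((\<Sum>(x,k)\<in>p. measure lborel k *\<^sub>R ?m x) - integral {0..l} ?m) < e / 3"
    by (metis (lifting))
  have "gauge (\<lambda>x. ga x \<inter> gb x \<inter> gm x)" using ga(1) gb(1) gm(1) by (intro gauge_Int)
  then obtain p where p: "p tagged_division_of {0..l}" "(\<lambda>x. ga x \<inter> gb x \<inter> gm x) fine p"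
    by (rule fine_division_exists_real)
  have pc: "p tagged_division_of cbox 0 l" using p(1) by simp
  have pp: "p tagged_partial_division_of cbox 0 l" using pc by (simp add: tagged_division_of_def)
  have fin: "ga fine p" "gb fine p" "gm fine p" using p(2) by (auto simp: fine_Int)
  have "\<bar>h l - h 0\<bar> = \<bar>\<Sum>(x,K)\<in>p. h (Sup K) - h (Inf K)\<bar>"
    using additive_tagged_division_1[OF l p(1), of h] by simp
  also have "\<dots> \<le> (\<Sum>(x,K)\<in>p. \<bar>h (Sup K) - h (Inf K)\<bar>)"
    using sum_abs[of "\<lambda>(x,K). h (Sup K) - h (Inf K)" p] by (simp add: case_prod_unfold)
  also have "\<dots> \<le> (\<Sum>(x,K)\<in>p. measure lborel K *\<^sub>R ?m x + norm (measure lborel K *\<^sub>R a x - integral K a)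
      + norm (measure lborel K *\<^sub>R b x - integral K b))"
  proof (rule sum_mono, clarify)
    fix x K assume xK: "(x, K) \<in> p"
    obtain u v where K: "K = {u..v}" using tagged_division_ofD(4)[OF p(1) xK] by auto
    have "x \<in> K" "K \<subseteq> {0..l}" using tagged_division_ofD(2,3)[OF p(1) xK] by auto
    then have uv: "u \<le> v" "0 \<le> u" "v \<le> l" using K by auto
    have "\<bar>h (Sup K) - h (Inf K)\<bar> \<le> integral K a" "\<bar>h (Sup K) - h (Inf K)\<bar> \<le> integral K b"
      using ha[OF uv(2,1,3)] hb[OF uv(2,1,3)] K uv(1) by simp_all
    then show "\<bar>h (Sup K) - h (Inf K)\<bar> \<le> measure lborel K *\<^sub>R ?m x + norm (measure lborel K *\<^sub>R a x - integral K a)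
      + norm (measure lborel K *\<^sub>R b x - integral K b)"
      \<comment> \<open>The error term of the function that is smaller at the tag converts its
        integral over \<open>K\<close> into the measure of \<open>K\<close> times the minimum; the
        other error term is only known to be nonnegative.\<close>
      by (cases "a x \<le> b x") (auto simp: min_def)
  qed
  also have "\<dots> = (\<Sum>(x,K)\<in>p. measure lborel K *\<^sub>R ?m x) + (\<Sum>(x,K)\<in>p. norm (measure lborel K *\<^sub>R a x - integral K a))
      + (\<Sum>(x,K)\<in>p. norm (measure lborel K *\<^sub>R b x - integral K b))"
    by (simp add: sum.distrib case_prod_unfold)
  also have "\<dots> \<le> (integral {0..l} ?m + e / 3) + e / 3 + e / 3"
  proof (intro add_mono)
    show "(\<Sum>(x,K)\<in>p. measure lborel K *\<^sub>R ?m x) \<le> integral {0..l} ?m + e / 3"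
      using gm(2)[OF pc fin(3)] unfolding real_norm_def by linarith
    show "(\<Sum>(x,K)\<in>p. norm (measure lborel K *\<^sub>R a x - integral K a)) \<le> e / 3"
      using ga(2)[OF pp fin(1)] by (rule less_imp_le)
    show "(\<Sum>(x,K)\<in>p. norm (measure lborel K *\<^sub>R b x - integral K b)) \<le> e / 3"
      using gb(2)[OF pp fin(2)] by (rule less_imp_le)
  qed
  finally show "\<bar>h l - h 0\<bar> \<le> integral {0..l} ?m + e" by simp
qed

text \<open>Bridge to the gauge integral. \<open>enn2real\<close> turns infinite values into 0, but
  by integrability these occur only on a null set.\<close>

lemma nn_integral_interval_finite:
  fixes G :: "real \<Rightarrow> ennreal"
  assumes G[measurable]: "G \<in> borel_measurable borel" and fin: "(\<integral>\<^sup>+t. G t \<partial>lborel) < \<infinity>"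
  shows "(\<lambda>t. enn2real (G t)) integrable_on {a..b}" (is ?A)
    and "(\<integral>\<^sup>+t\<in>{a..b}. G t \<partial>lborel) = ennreal (integral {a..b} (\<lambda>t. enn2real (G t)))" (is ?B)
proof -
  define r where "r = enn2real (\<integral>\<^sup>+t\<in>{a..b}. G t \<partial>lborel)"
  have "(\<integral>\<^sup>+t\<in>{a..b}. G t \<partial>lborel) \<le> (\<integral>\<^sup>+t. G t \<partial>lborel)"
    by (intro nn_integral_mono) (auto split: split_indicator)
  then have r: "(\<integral>\<^sup>+t\<in>{a..b}. G t \<partial>lborel) = ennreal r" "0 \<le> r"
    using fin by (auto simp: r_def)
  have "AE t in lborel. G t \<noteq> \<infinity>"
    using fin by (intro nn_integral_noteq_infinite) auto
  then have "(\<integral>\<^sup>+t. ennreal (indicator {a..b} t * enn2real (G t)) \<partial>lborel) = (\<integral>\<^sup>+t\<in>{a..b}. G t \<partial>lborel)"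
  proof (intro nn_integral_cong_AE, eventually_elim)
    case (elim t)
    then have "ennreal (enn2real (G t)) = G t" by (simp add: less_top)
    then show ?case by (simp split: split_indicator)
  qed
  then have "((\<lambda>t. indicator {a..b} t * enn2real (G t)) has_integral r) UNIV"
    using r by (intro nn_integral_has_integral) simp_all
  moreover have "(\<lambda>t. indicator {a..b} t * enn2real (G t)) = (\<lambda>t. if t \<in> {a..b} then enn2real (G t) else 0)"
    by (rule ext) (simp add: indicator_def)
  ultimately have "((\<lambda>t. if t \<in> {a..b} then enn2real (G t) else 0) has_integral r) UNIV"
    by simp
  then have "((\<lambda>t. enn2real (G t)) has_integral r) {a..b}"
    by (simp only: has_integral_restrict_UNIV)
  then show ?A ?B using r by (auto simp: integral_unique)
qed

text \<open>The Newton-Leibniz bound for \<open>f \<circ> \<gamma>\<close> on all subintervals, in place of absolute continuity of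
  \<open>f \<circ> \<gamma>\<close> with derivative at most \<open>g \<circ> \<gamma>\<close>.\<close>

definition curve_bound ::
    "('a::metric_space \<Rightarrow> ereal) \<Rightarrow> ('a \<Rightarrow> ennreal) \<Rightarrow> (real \<Rightarrow> 'a) \<Rightarrow> real \<Rightarrow> bool" where
  "curve_bound f g \<gamma> l \<longleftrightarrow> line_integral g \<gamma> l < \<infinity> \<and>
     (\<exists>h. (\<forall>t\<in>{0..l}. f (\<gamma> t) = ereal (h t)) \<and>
       (\<forall>s t. 0 \<le> s \<longrightarrow> s \<le> t \<longrightarrow> t \<le> l \<longrightarrow>
          ennreal \<bar>h t - h s\<bar> \<le> (\<integral>\<^sup>+\<tau>\<in>{s..t}. g (\<gamma> \<tau>) \<partial>lborel)))"

lemma ext_dist_ereal: "ext_dist (ereal a) (ereal b) = ennreal \<bar>a - b\<bar>"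
  by (simp add: ext_dist_def)

lemma ext_dist_finite: "ext_dist a b < \<infinity> \<Longrightarrow> \<bar>a\<bar> \<noteq> \<infinity> \<and> \<bar>b\<bar> \<noteq> \<infinity>"
  by (auto simp: ext_dist_def split: if_splits)

text \<open>Since \<open>ext_dist\<close> is infinite at infinite values, a finite line integral
  forces \<open>f\<close> to be finite at every point of the curve: each point is an endpoint of
  some nondegenerate subcurve. This provides the real function \<open>h\<close>.\<close>

lemma curve_boundI:
  assumes "arc_length_curve \<gamma> l" "g \<in> borel_measurable borel" "line_integral g \<gamma> l < \<infinity>"
    and sub: "\<And>a b. 0 \<le> a \<Longrightarrow> a < b \<Longrightarrow> b \<le> l \<Longrightarrow>
      ext_dist (f (\<gamma> a)) (f (\<gamma> b)) \<le> line_integral g (\<lambda>t. \<gamma> (a + t)) (b - a)"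
  shows "curve_bound f g \<gamma> l"
proof -
  have l: "0 < l" using assms by (simp add: arc_length_curve_def)
  have sub': "ext_dist (f (\<gamma> a)) (f (\<gamma> b)) \<le> (\<integral>\<^sup>+\<tau>\<in>{a..b}. g (\<gamma> \<tau>) \<partial>lborel)"
    if "0 \<le> a" "a < b" "b \<le> l" for a b
    using sub[OF that] line_integral_sub[OF assms(1,2), of a b] that by simp
  have fin: "\<bar>f (\<gamma> a)\<bar> \<noteq> \<infinity> \<and> \<bar>f (\<gamma> b)\<bar> \<noteq> \<infinity>" if "0 \<le> a" "a < b" "b \<le> l" for a b
  proof (rule ext_dist_finite)
    have "(\<integral>\<^sup>+\<tau>\<in>{a..b}. g (\<gamma> \<tau>) \<partial>lborel) \<le> line_integral g \<gamma> l"
      unfolding line_integral_lborel using that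
      by (intro nn_integral_mono) (auto split: split_indicator)
    then show "ext_dist (f (\<gamma> a)) (f (\<gamma> b)) < \<infinity>"
      using sub'[OF that] assms(3) by (meson le_less_trans)
  qed
  define h where "h t = real_of_ereal (f (\<gamma> t))" for t
  have h: "f (\<gamma> t) = ereal (h t)" if "t \<in> {0..l}" for t
  proof (cases "t = 0")
    case True then show ?thesis using fin[of 0 l] l by (simp add: h_def ereal_real)
  next
    case False then show ?thesis using fin[of 0 t] that by (simp add: h_def ereal_real)
  qed
  have "ennreal \<bar>h t - h s\<bar> \<le> (\<integral>\<^sup>+\<tau>\<in>{s..t}. g (\<gamma> \<tau>) \<partial>lborel)" if "0 \<le> s" "s \<le> t" "t \<le> l" for s t
  proof (cases "s = t")
    case False
    then show ?thesis using sub'[of s t] that by (simp add: h ext_dist_ereal abs_minus_commute)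
  qed simp
  then show ?thesis unfolding curve_bound_def using assms(3) h by blast
qed

text \<open>Two families are discarded: curves with a subcurve violating the inequality, and curves
  along which \<open>g\<close> has infinite integral, for which \<open>g\<close> itself serves as
  the density.\<close>

lemma wug_curve_bound:
  fixes M :: "'a::metric_space measure"
  assumes M: "metric_measure_space M" and p: "0 < p"
    and g: "g \<in> borel_measurable borel" "(\<integral>\<^sup>+x. enn_powr (g x) p \<partial>M) < \<infinity>"
    and w: "weak_upper_gradient M p f g"
  shows "p_exceptional M p {(\<gamma>, l). arc_length_curve \<gamma> l \<and> \<not> curve_bound f g \<gamma> l}"
proof -
  define \<Gamma> where "\<Gamma> = {(\<gamma>, l). arc_length_curve \<gamma> l \<and>
       \<not> ext_dist (f (\<gamma> 0)) (f (\<gamma> l)) \<le> line_integral g \<gamma> l}"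
  define \<Gamma>' where "\<Gamma>' = {(\<gamma>, l). arc_length_curve \<gamma> l \<and>
    (\<exists>a b. 0 \<le> a \<and> a < b \<and> b \<le> l \<and> ((\<lambda>t. \<gamma> (a + t)), b - a) \<in> \<Gamma>)}"
  define \<Delta> where "\<Delta> = {(\<gamma>, l). arc_length_curve (\<gamma> :: real \<Rightarrow> 'a) l \<and> line_integral g \<gamma> l = \<infinity>}"
  have "p_exceptional M p \<Gamma>" using w by (simp add: weak_upper_gradient_def \<Gamma>_def)
  then have "p_exceptional M p \<Gamma>'" unfolding \<Gamma>'_def by (rule p_exceptional_super[OF M])
  moreover have "p_exceptional M p \<Delta>"
    using p_exceptionalI[OF M g, of \<Delta>] by (simp add: \<Delta>_def)
  ultimately have "p_exceptional M p (\<Gamma>' \<union> \<Delta>)"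
    by (intro p_exceptional_Un M p) (auto simp: \<Gamma>'_def \<Delta>_def)
  then show ?thesis
  proof (rule p_exceptional_subset, intro subsetI, clarify)
    fix \<gamma> l assume c: "arc_length_curve \<gamma> l" "\<not> curve_bound f g \<gamma> l" "(\<gamma>, l) \<notin> \<Delta>"
    show "(\<gamma>, l) \<in> \<Gamma>'"
    proof (rule ccontr)
      assume n: "(\<gamma>, l) \<notin> \<Gamma>'"
      have "curve_bound f g \<gamma> l"
      proof (rule curve_boundI[OF c(1) g(1)])
        show "line_integral g \<gamma> l < \<infinity>" using c by (simp add: \<Delta>_def less_top)
        fix a b :: real assume ab: "0 \<le> a" "a < b" "b \<le> l"
        then have "((\<lambda>t. \<gamma> (a + t)), b - a) \<notin> \<Gamma>" using n c(1) unfolding \<Gamma>'_def by blast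
        then show "ext_dist (f (\<gamma> a)) (f (\<gamma> b)) \<le> line_integral g (\<lambda>t. \<gamma> (a + t)) (b - a)"
          using arc_length_curve_sub[OF c(1) ab] by (simp add: \<Gamma>_def)
      qed
      then show False using c by simp
    qed
  qed
qed

text \<open>Both bounds concern the same function \<open>f \<circ> \<gamma>\<close>, so the estimate
  for real functions applies once the integrals are rewritten as gauge integrals of finite
  integrands.\<close>

lemma curve_bound_min:
  assumes \<gamma>: "arc_length_curve \<gamma> l" and g: "g1 \<in> borel_measurable borel" "g2 \<in> borel_measurable borel"
    and cb: "curve_bound f g1 \<gamma> l" "curve_bound f g2 \<gamma> l"
  shows "ext_dist (f (\<gamma> 0)) (f (\<gamma> l)) \<le> line_integral (\<lambda>x. min (g1 x) (g2 x)) \<gamma> l"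
proof -
  have l: "0 < l" and cont: "continuous_on {0..l} \<gamma>" using \<gamma> by (auto simp: arc_length_curve_def)
  define G1 where "G1 t = g1 (\<gamma> t) * indicator {0..l} t" for t
  define G2 where "G2 t = g2 (\<gamma> t) * indicator {0..l} t" for t
  have G[measurable]: "G1 \<in> borel_measurable borel" "G2 \<in> borel_measurable borel"
    unfolding G1_def G2_def using cont g by (auto intro!: measurable_along_curve)
  have fin: "(\<integral>\<^sup>+t. G1 t \<partial>lborel) < \<infinity>" "(\<integral>\<^sup>+t. G2 t \<partial>lborel) < \<infinity>"
    using cb by (auto simp: curve_bound_def line_integral_lborel G1_def G2_def)
  have minle: "(\<integral>\<^sup>+t. min (G1 t) (G2 t) \<partial>lborel) \<le> (\<integral>\<^sup>+t. G1 t \<partial>lborel)"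
    by (intro nn_integral_mono) auto
  note I1 = nn_integral_interval_finite[OF G(1) fin(1)]
  note I2 = nn_integral_interval_finite[OF G(2) fin(2)]
  have I3: "(\<lambda>t. enn2real (min (G1 t) (G2 t))) integrable_on {0..l}"
    by (rule nn_integral_interval_finite) (use minle fin in auto)
  obtain h1 where h1: "\<forall>t\<in>{0..l}. f (\<gamma> t) = ereal (h1 t)"
      "\<And>s t. 0 \<le> s \<Longrightarrow> s \<le> t \<Longrightarrow> t \<le> l \<Longrightarrow> ennreal \<bar>h1 t - h1 s\<bar> \<le> (\<integral>\<^sup>+\<tau>\<in>{s..t}. g1 (\<gamma> \<tau>) \<partial>lborel)"
    using cb(1) unfolding curve_bound_def by blast
  obtain h2 where h2: "\<forall>t\<in>{0..l}. f (\<gamma> t) = ereal (h2 t)"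
      "\<And>s t. 0 \<le> s \<Longrightarrow> s \<le> t \<Longrightarrow> t \<le> l \<Longrightarrow> ennreal \<bar>h2 t - h2 s\<bar> \<le> (\<integral>\<^sup>+\<tau>\<in>{s..t}. g2 (\<gamma> \<tau>) \<partial>lborel)"
    using cb(2) unfolding curve_bound_def by blast
  have h12: "h2 t = h1 t" if "t \<in> {0..l}" for t using h1(1) h2(1) that by auto
  have sub: "(\<integral>\<^sup>+\<tau>\<in>{s..t}. g1 (\<gamma> \<tau>) \<partial>lborel) = (\<integral>\<^sup>+\<tau>\<in>{s..t}. G1 \<tau> \<partial>lborel)"
    "(\<integral>\<^sup>+\<tau>\<in>{s..t}. g2 (\<gamma> \<tau>) \<partial>lborel) = (\<integral>\<^sup>+\<tau>\<in>{s..t}. G2 \<tau> \<partial>lborel)"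
    if "0 \<le> s" "t \<le> l" for s t
    using that by (auto intro!: nn_integral_cong simp: G1_def G2_def split: split_indicator)
  have min_eq: "AE t in lborel. min (enn2real (G1 t)) (enn2real (G2 t)) = enn2real (min (G1 t) (G2 t))"
  proof -
    have "AE t in lborel. G1 t \<noteq> \<infinity>"
      by (rule nn_integral_noteq_infinite) (use fin in auto)
    moreover have "AE t in lborel. G2 t \<noteq> \<infinity>"
      by (rule nn_integral_noteq_infinite) (use fin in auto)
    ultimately show ?thesis
    proof eventually_elim
      case (elim t)
      then show ?case
        using enn2real_mono[of "G1 t" "G2 t"] enn2real_mono[of "G2 t" "G1 t"]
        by (cases "G1 t \<le> G2 t") (auto simp: min_def less_top)
    qed
  qed
  \<comment> \<open>\<open>enn2real\<close> sends infinity to 0 and so commutes with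
    \<open>min\<close> only where both values are finite; the exceptions form a negligible
    set.\<close>
  define N where "N = {t. min (enn2real (G1 t)) (enn2real (G2 t)) \<noteq> enn2real (min (G1 t) (G2 t))}"
  have "AE t in lebesgue. min (enn2real (G1 t)) (enn2real (G2 t)) = enn2real (min (G1 t) (G2 t))"
    using min_eq by (rule AE_completion)
  then have "\<exists>N'. negligible N' \<and> N \<subseteq> N'"
    unfolding eventually_ae_filter_negligible N_def .
  then have "negligible N" by (elim exE conjE) (rule negligible_subset)
  then have N: "negligible N" "\<And>t. t \<notin> N \<Longrightarrow>
      min (enn2real (G1 t)) (enn2real (G2 t)) = enn2real (min (G1 t) (G2 t))"
    unfolding N_def by auto
  have I4: "(\<lambda>t. min (enn2real (G1 t)) (enn2real (G2 t))) integrable_on {0..l}"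
    by (rule integrable_spike[OF I3 N(1)]) (simp add: N(2))
  have "\<bar>h1 l - h1 0\<bar> \<le> integral {0..l} (\<lambda>t. min (enn2real (G1 t)) (enn2real (G2 t)))"
  proof (rule increment_le_integral_min)
    fix s t assume st: "0 \<le> s" "s \<le> t" "t \<le> l"
    have "ennreal \<bar>h1 t - h1 s\<bar> \<le> ennreal (integral {s..t} (\<lambda>t. enn2real (G1 t)))"
      using h1(2)[OF st] st by (simp add: sub I1(2))
    then show "\<bar>h1 t - h1 s\<bar> \<le> integral {s..t} (\<lambda>t. enn2real (G1 t))"
      by (subst (asm) ennreal_le_iff) (auto intro!: integral_nonneg I1(1))
    have "ennreal \<bar>h1 t - h1 s\<bar> \<le> ennreal (integral {s..t} (\<lambda>t. enn2real (G2 t)))"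
      using h2(2)[OF st] st by (simp add: sub I2(2) h12)
    then show "\<bar>h1 t - h1 s\<bar> \<le> integral {s..t} (\<lambda>t. enn2real (G2 t))"
      by (subst (asm) ennreal_le_iff) (auto intro!: integral_nonneg I2(1))
  qed (use l in \<open>simp_all add: I1(1) I2(1) I4\<close>)
  also have "\<dots> = integral {0..l} (\<lambda>t. enn2real (min (G1 t) (G2 t)))"
    using N by (intro integral_spike[of N]) auto
  finally have "ennreal \<bar>h1 l - h1 0\<bar> \<le> ennreal (integral {0..l} (\<lambda>t. enn2real (min (G1 t) (G2 t))))"
    by (rule ennreal_leI)
  also have "\<dots> = (\<integral>\<^sup>+t\<in>{0..l}. min (G1 t) (G2 t) \<partial>lborel)"
    by (rule nn_integral_interval_finite(2)[symmetric]) (use minle fin in auto)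
  also have "\<dots> = line_integral (\<lambda>x. min (g1 x) (g2 x)) \<gamma> l"
    unfolding line_integral_lborel
    by (intro nn_integral_cong) (auto simp: G1_def G2_def split: split_indicator)
  finally show ?thesis using h1(1) l by (simp add: ext_dist_ereal abs_minus_commute)
qed

lemma curve_bound_ext_dist:
  assumes "curve_bound f g \<gamma> l" "0 < l"
  shows "ext_dist (f (\<gamma> 0)) (f (\<gamma> l)) \<le> line_integral g \<gamma> l"
proof -
  obtain h where h: "\<forall>t\<in>{0..l}. f (\<gamma> t) = ereal (h t)"
      "\<And>s t. 0 \<le> s \<Longrightarrow> s \<le> t \<Longrightarrow> t \<le> l \<Longrightarrow> ennreal \<bar>h t - h s\<bar> \<le> (\<integral>\<^sup>+\<tau>\<in>{s..t}. g (\<gamma> \<tau>) \<partial>lborel)"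
    using assms(1) unfolding curve_bound_def by blast
  then show ?thesis using h(2)[of 0 l] assms(2)
    by (simp add: ext_dist_ereal abs_minus_commute line_integral_lborel)
qed

text \<open>As \<open>f \<circ> \<gamma>\<close> takes the same value at the first and the last visit to \<open>E\<close>, only the parts of the
  curve before and after these contribute; visits are approximated, since \<open>E\<close> need not be closed.\<close>

lemma curve_bound_restrict:
  fixes g :: "'a::metric_space \<Rightarrow> ennreal"
  assumes \<gamma>: "arc_length_curve \<gamma> l" and g: "g \<in> borel_measurable borel"
    and cb: "curve_bound f g \<gamma> l" and E: "\<And>x. x \<in> E \<Longrightarrow> f x = ereal c"
  shows "ext_dist (f (\<gamma> 0)) (f (\<gamma> l)) \<le> line_integral (\<lambda>x. g x * indicator (- E) x) \<gamma> l"
proof (cases "\<exists>t\<in>{0..l}. \<gamma> t \<in> E")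
  case False
  have "0 < l" using \<gamma> by (simp add: arc_length_curve_def)
  moreover have "line_integral (\<lambda>x. g x * indicator (- E) x) \<gamma> l = line_integral g \<gamma> l"
    unfolding line_integral_def using False
    by (intro nn_integral_cong) (auto split: split_indicator)
  ultimately show ?thesis using curve_bound_ext_dist[OF cb] by simp
next
  case True
  define F where "F = {t \<in> {0..l}. \<gamma> t \<in> E}"
  have F: "F \<noteq> {}" "F \<subseteq> {0..l}" using True by (auto simp: F_def)
  have l: "0 < l" and cont: "continuous_on {0..l} \<gamma>" using \<gamma> by (auto simp: arc_length_curve_def)
  define G where "G t = g (\<gamma> t) * indicator {0..l} t" for t
  have G[measurable]: "G \<in> borel_measurable borel"
    unfolding G_def using cont g by (auto intro!: measurable_along_curve)
  have fin: "(\<integral>\<^sup>+t. G t \<partial>lborel) < \<infinity>"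
    using cb by (auto simp: curve_bound_def line_integral_lborel G_def)
  note I = nn_integral_interval_finite[OF G fin]
  obtain h where h: "\<forall>t\<in>{0..l}. f (\<gamma> t) = ereal (h t)"
      "\<And>s t. 0 \<le> s \<Longrightarrow> s \<le> t \<Longrightarrow> t \<le> l \<Longrightarrow> ennreal \<bar>h t - h s\<bar> \<le> (\<integral>\<^sup>+\<tau>\<in>{s..t}. g (\<gamma> \<tau>) \<partial>lborel)"
    using cb unfolding curve_bound_def by blast
  have hF: "h t = c" if "t \<in> F" for t
    using that h(1) E[of "\<gamma> t"] by (auto simp: F_def)
  define A where "A t = enn2real (G t)" for t
  define J where "J s = integral {0..s} A" for s
  have A: "A integrable_on {s..t}" for s t unfolding A_def by (rule I(1))
  have sub: "(\<integral>\<^sup>+\<tau>\<in>{s..t}. g (\<gamma> \<tau>) \<partial>lborel) = ennreal (integral {s..t} A)" if "0 \<le> s" "t \<le> l" for s t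
  proof -
    have "(\<integral>\<^sup>+\<tau>\<in>{s..t}. g (\<gamma> \<tau>) \<partial>lborel) = (\<integral>\<^sup>+\<tau>\<in>{s..t}. G \<tau> \<partial>lborel)"
      using that by (intro nn_integral_cong) (simp add: G_def split: split_indicator)
    then show ?thesis unfolding A_def I(2) .
  qed
  have A0: "0 \<le> integral {s..t} A" for s t
    by (rule integral_nonneg[OF A]) (simp add: A_def)
  have hJ: "\<bar>h t - h s\<bar> \<le> integral {s..t} A" if "0 \<le> s" "s \<le> t" "t \<le> l" for s t
  proof -
    have "ennreal \<bar>h t - h s\<bar> \<le> ennreal (integral {s..t} A)"
      using h(2)[OF that] sub[of s t] that by simp
    then show ?thesis using A0[of s t] by (simp add: ennreal_le_iff)
  qed
  have J_split: "integral {t..l} A = J l - J t" if "t \<in> {0..l}" for t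
    using Henstock_Kurzweil_Integration.integral_combine[of 0 t l A] A that by (simp add: J_def)
  have Jcont: "continuous_on {0..l} J"
    unfolding J_def by (rule indefinite_integral_continuous_1[OF A])
  have clF: "closure F \<subseteq> {0..l}" using F(2) by (simp add: closure_minimal)
  \<comment> \<open>As \<open>h s = h t = c\<close>, the total increment splits into
    \<open>h s - h 0\<close> and \<open>h l - h t\<close>. This is valid in either order of
    \<open>s\<close> and \<open>t\<close>.\<close>
  have FF: "\<bar>h l - h 0\<bar> \<le> J s + (J l - J t)" if "s \<in> F" "t \<in> F" for s t
  proof -
    have st: "s \<in> {0..l}" "t \<in> {0..l}" using that F by auto
    then show ?thesis using hJ[of 0 s] hJ[of t l] J_split[of t] hF[OF that(1)] hF[OF that(2)]
      by (simp add: J_def)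
  qed
  \<comment> \<open>The right side is continuous in each variable, so the bound passes to the
    closure of \<open>F\<close> one variable at a time; this reaches \<open>Inf F\<close> and
    \<open>Sup F\<close>, which may fall outside \<open>F\<close>.\<close>
  have FC: "\<bar>h l - h 0\<bar> \<le> J s + (J l - J t)" if "s \<in> F" "t \<in> closure F" for s t
    by (rule continuous_ge_on_closure[of F "\<lambda>t. J s + (J l - J t)"])
      (use that FF in \<open>auto intro!: continuous_intros continuous_on_subset[OF Jcont clF]\<close>)
  have CC: "\<bar>h l - h 0\<bar> \<le> J s + (J l - J t)" if "s \<in> closure F" "t \<in> closure F" for s t
    by (rule continuous_ge_on_closure[of F "\<lambda>s. J s + (J l - J t)"])
      (use that FC in \<open>auto intro!: continuous_intros continuous_on_subset[OF Jcont clF]\<close>)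
  define a where "a = Inf F"
  define b where "b = Sup F"
  have bdd: "bdd_below F" "bdd_above F"
    using F(2) by (auto intro: bdd_below_mono bdd_above_mono)
  have ab: "a \<in> closure F" "b \<in> closure F"
    using closure_contains_Inf[OF F(1) bdd(1)] closure_contains_Sup[OF F(1) bdd(2)]
    by (auto simp: a_def b_def)
  have ab_l: "a \<in> {0..l}" "b \<in> {0..l}" using ab clF by auto
  have Fab: "a \<le> t" "t \<le> b" if "t \<in> F" for t
    using cInf_lower[OF that bdd(1)] cSup_upper[OF that bdd(2)] by (auto simp: a_def b_def)
  then have "a \<le> b" using F(1) by (meson all_not_in_conv order_trans)
  have "ennreal \<bar>h l - h 0\<bar> \<le> ennreal (J a + (J l - J b))"
    by (intro ennreal_leI CC ab)
  also have "\<dots> = ennreal (integral {0..a} A) + ennreal (integral {b..l} A)"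
    unfolding J_split[OF ab_l(2), symmetric] unfolding J_def by (rule ennreal_plus) (rule A0)+
  also have "\<dots> = (\<integral>\<^sup>+t\<in>{0..a}. G t \<partial>lborel) + (\<integral>\<^sup>+t\<in>{b..l}. G t \<partial>lborel)"
    unfolding A_def I(2) ..
  also have "\<dots> = (\<integral>\<^sup>+t. G t * indicator {0..a} t + G t * indicator {b..l} t \<partial>lborel)"
    by (intro nn_integral_add[symmetric]) measurable
  also have "\<dots> \<le> (\<integral>\<^sup>+t\<in>{0..l}. g (\<gamma> t) * indicator (- E) (\<gamma> t) \<partial>lborel)"
  proof (intro nn_integral_mono_AE)
    \<comment> \<open>Off these two points no visit to \<open>E\<close> lies in
      \<open>{0..a}\<close> or \<open>{b..l}\<close>, and the two intervals do not overlap, so the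
      integrand on the left is dominated by \<open>g\<close> restricted to the complement of
      \<open>E\<close>.\<close>
    have "AE t in lborel. t \<noteq> a" "AE t in lborel. t \<noteq> b" by (rule AE_lborel_singleton)+
    then show "AE t in lborel. G t * indicator {0..a} t + G t * indicator {b..l} t
      \<le> g (\<gamma> t) * indicator (- E) (\<gamma> t) * indicator {0..l} t"
    proof eventually_elim
      case (elim t)
      show ?case
      proof (cases "t \<in> {0..l} \<and> \<gamma> t \<in> E")
        case True
        then have "t \<in> F" by (simp add: F_def)
        then show ?thesis using Fab elim by (force split: split_indicator)
      next
        case False
        then show ?thesis using elim \<open>a \<le> b\<close> ab_l by (auto simp: G_def split: split_indicator)
      qed
    qed
  qed
  also have "\<dots> = line_integral (\<lambda>x. g x * indicator (- E) x) \<gamma> l"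
    unfolding line_integral_lborel ..
  finally show ?thesis using h(1) l by (simp add: ext_dist_ereal abs_minus_commute)
qed

subsection \<open>Existence of minimal weak upper gradients\<close>

text \<open>Borel measurability makes compositions with curves measurable. Minimality may be tested
  within this class, because every weak upper gradient in \<open>L^p\<close> has an a.e. equal
  majorant in it.\<close>

definition borel_wug :: "'a::metric_space measure \<Rightarrow> real \<Rightarrow> ('a \<Rightarrow> ereal) \<Rightarrow> ('a \<Rightarrow> ennreal) set" where
  "borel_wug M p f = {g \<in> borel_measurable borel. (\<integral>\<^sup>+x. enn_powr (g x) p \<partial>M) < \<infinity> \<and>
     weak_upper_gradient M p f g}"

lemma borel_wugI:
  fixes M :: "'a::metric_space measure"
  assumes M: "metric_measure_space M" and g: "g \<in> borel_measurable borel"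
      "(\<integral>\<^sup>+x. enn_powr (g x) p \<partial>M) < \<infinity>"
    and ex: "p_exceptional M p \<Gamma>"
    and "\<And>\<gamma> l. arc_length_curve \<gamma> l \<Longrightarrow> (\<gamma>, l) \<notin> \<Gamma> \<Longrightarrow>
      ext_dist (f (\<gamma> 0)) (f (\<gamma> l)) \<le> line_integral g \<gamma> l"
  shows "g \<in> borel_wug M p f"
  unfolding borel_wug_def weak_upper_gradient_def
  using g mms_borel_measurable[OF M g(1)] assms(5)
  by (auto intro!: p_exceptional_subset[OF ex])

lemma upper_gradient_borel_wug:
  assumes M: "metric_measure_space M"
    and "upper_gradient f g" "(\<integral>\<^sup>+x. enn_powr (g x) p \<partial>M) < \<infinity>"
  shows "g \<in> borel_wug M p f"
proof (rule borel_wugI[OF M])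
  show "p_exceptional M p {}"
    by (rule p_exceptionalI[OF M, of "\<lambda>_. 0"]) (auto simp: enn_powr_0)
qed (use assms in \<open>auto simp: upper_gradient_def\<close>)

lemma borel_wug_curve_bound:
  assumes "metric_measure_space M" "0 < p" "g \<in> borel_wug M p f"
  shows "p_exceptional M p {(\<gamma>, l). arc_length_curve \<gamma> l \<and> \<not> curve_bound f g \<gamma> l}"
  using assms wug_curve_bound unfolding borel_wug_def by blast

lemma borel_wug_min:
  assumes M: "metric_measure_space M" and p: "0 < p"
    and g: "g1 \<in> borel_wug M p f" "g2 \<in> borel_wug M p f"
  shows "(\<lambda>x. min (g1 x) (g2 x)) \<in> borel_wug M p f"
proof (rule borel_wugI[OF M])
  have b[measurable]: "g1 \<in> borel_measurable borel" "g2 \<in> borel_measurable borel"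
    using g by (auto simp: borel_wug_def)
  show "(\<lambda>x. min (g1 x) (g2 x)) \<in> borel_measurable borel" by measurable
  have "(\<integral>\<^sup>+x. enn_powr (min (g1 x) (g2 x)) p \<partial>M) \<le> (\<integral>\<^sup>+x. enn_powr (g1 x) p \<partial>M)"
    using p by (intro nn_integral_mono enn_powr_mono) auto
  then show "(\<integral>\<^sup>+x. enn_powr (min (g1 x) (g2 x)) p \<partial>M) < \<infinity>"
    using g(1) by (auto simp: borel_wug_def)
  show "p_exceptional M p ({(\<gamma>, l). arc_length_curve \<gamma> l \<and> \<not> curve_bound f g1 \<gamma> l} \<union>
      {(\<gamma>, l). arc_length_curve \<gamma> l \<and> \<not> curve_bound f g2 \<gamma> l})"
    by (intro p_exceptional_Un[OF M p] borel_wug_curve_bound[OF M p] g) auto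
  fix \<gamma> l assume "arc_length_curve \<gamma> l"
    "(\<gamma>, l) \<notin> {(\<gamma>, l). arc_length_curve \<gamma> l \<and> \<not> curve_bound f g1 \<gamma> l} \<union>
      {(\<gamma>, l). arc_length_curve \<gamma> l \<and> \<not> curve_bound f g2 \<gamma> l}"
  then show "ext_dist (f (\<gamma> 0)) (f (\<gamma> l)) \<le> line_integral (\<lambda>x. min (g1 x) (g2 x)) \<gamma> l"
    by (intro curve_bound_min b) auto
qed

text \<open>Localizes the gradient of an admissible function to the annulus, with \<open>E\<close>
  first the inner ball and then the complement of the outer one.\<close>

lemma borel_wug_restrict:
  assumes M: "metric_measure_space M" and p: "0 < p" and g: "g \<in> borel_wug M p f"
    and E: "E \<in> sets borel" "\<And>x. x \<in> E \<Longrightarrow> f x = ereal c"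
  shows "(\<lambda>x. g x * indicator (- E) x) \<in> borel_wug M p f"
proof (rule borel_wugI[OF M _ _ borel_wug_curve_bound[OF M p g]])
  have b[measurable]: "g \<in> borel_measurable borel" "E \<in> sets borel"
    using g E by (auto simp: borel_wug_def)
  show "(\<lambda>x. g x * indicator (- E) x) \<in> borel_measurable borel" by measurable
  have "(\<integral>\<^sup>+x. enn_powr (g x * indicator (- E) x) p \<partial>M) \<le> (\<integral>\<^sup>+x. enn_powr (g x) p \<partial>M)"
    using p by (intro nn_integral_mono enn_powr_mono) (auto split: split_indicator)
  then show "(\<integral>\<^sup>+x. enn_powr (g x * indicator (- E) x) p \<partial>M) < \<infinity>"
    using g by (auto simp: borel_wug_def)
  fix \<gamma> l assume "arc_length_curve \<gamma> l"
    "(\<gamma>, l) \<notin> {(\<gamma>, l). arc_length_curve \<gamma> l \<and> \<not> curve_bound f g \<gamma> l}"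
  then show "ext_dist (f (\<gamma> 0)) (f (\<gamma> l)) \<le> line_integral (\<lambda>x. g x * indicator (- E) x) \<gamma> l"
    by (intro curve_bound_restrict[where c=c] b) (auto simp: E(2))
qed

text \<open>Along a curve that is good for every \<open>G n\<close>, the line integrals decrease
  from a finite value, so monotone convergence passes the inequality to the limit; the exceptional
  curves form a countable union.\<close>

lemma borel_wug_INF:
  fixes M :: "'a::metric_space measure"
  assumes M: "metric_measure_space M" and p: "0 < p"
    and G: "\<And>n. G n \<in> borel_wug M p f" and dec: "\<And>n x. G (Suc n) x \<le> G n x"
  shows "(\<lambda>x. INF n. G n x) \<in> borel_wug M p f"
proof (rule borel_wugI[OF M])
  have b[measurable]: "G n \<in> borel_measurable borel" for n
    using G by (auto simp: borel_wug_def)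
  show "(\<lambda>x. INF n. G n x) \<in> borel_measurable borel" by measurable
  have "(\<integral>\<^sup>+x. enn_powr (INF n. G n x) p \<partial>M) \<le> (\<integral>\<^sup>+x. enn_powr (G 0 x) p \<partial>M)"
    using p by (intro nn_integral_mono enn_powr_mono INF_lower) auto
  then show "(\<integral>\<^sup>+x. enn_powr (INF n. G n x) p \<partial>M) < \<infinity>"
    using G[of 0] by (auto simp: borel_wug_def)
  show "p_exceptional M p (\<Union>n. {(\<gamma>, l). arc_length_curve \<gamma> l \<and> \<not> curve_bound f (G n) \<gamma> l})"
    by (intro p_exceptional_UN[OF M p] borel_wug_curve_bound[OF M p] G) auto
  fix \<gamma> :: "real \<Rightarrow> 'a" and l assume \<gamma>: "arc_length_curve \<gamma> l"
    "(\<gamma>, l) \<notin> (\<Union>n. {(\<gamma>, l). arc_length_curve \<gamma> l \<and> \<not> curve_bound f (G n) \<gamma> l})"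
  then have cb: "curve_bound f (G n) \<gamma> l" for n by auto
  have l: "0 < l" "continuous_on {0..l} \<gamma>" using \<gamma>(1) by (auto simp: arc_length_curve_def)
  have "line_integral (\<lambda>x. INF n. G n x) \<gamma> l = (\<integral>\<^sup>+t. (INF n. G n (\<gamma> t) * indicator {0..l} t) \<partial>lborel)"
    unfolding line_integral_lborel by (intro nn_integral_cong) (simp split: split_indicator)
  also have "\<dots> = (INF n. line_integral (G n) \<gamma> l)"
    unfolding line_integral_lborel
  proof (rule nn_integral_monotone_convergence_INF_decseq)
    show "decseq (\<lambda>n t. G n (\<gamma> t) * indicator {0..l} t)"
      using dec by (intro decseq_SucI le_funI mult_right_mono) auto
    show "(\<lambda>t. G n (\<gamma> t) * indicator {0..l} t) \<in> borel_measurable lborel" for n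
      using measurable_along_curve[OF l(2) b, of 0 l] by simp
    show "(\<integral>\<^sup>+t\<in>{0..l}. G 0 (\<gamma> t) \<partial>lborel) < \<infinity>"
      using cb[of 0] by (simp add: curve_bound_def line_integral_lborel)
  qed
  finally show "ext_dist (f (\<gamma> 0)) (f (\<gamma> l)) \<le> line_integral (\<lambda>x. INF n. G n x) \<gamma> l"
    using curve_bound_ext_dist[OF cb l(1)] by (auto intro!: INF_greatest)
qed

lemma enn_powr_le_cancel:
  assumes "0 < p" "enn_powr a p \<le> enn_powr b p"
  shows "a \<le> b"
  using enn_powr_mono[OF _ assms(2), of "1/p"] assms(1) by (simp add: enn_powr_powr)

lemma borel_wug_majorant:
  assumes M: "metric_measure_space M" and h: "h \<in> Lp_nonneg M p" "weak_upper_gradient M p f h"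
  obtains h' where "h' \<in> borel_wug M p f" "AE x in M. h' x = h x"
proof -
  have hM: "h \<in> borel_measurable M" "(\<integral>\<^sup>+x. enn_powr (h x) p \<partial>M) < \<infinity>"
    using h(1) by (auto simp: Lp_nonneg_def)
  obtain h' where h': "h' \<in> borel_measurable borel" "\<And>x. h x \<le> h' x" "AE x in M. h' x = h x"
    using borel_majorant[OF M hM(1)] by blast
  have "(\<integral>\<^sup>+x. enn_powr (h' x) p \<partial>M) = (\<integral>\<^sup>+x. enn_powr (h x) p \<partial>M)"
    by (intro nn_integral_cong_AE) (use h'(3) in eventually_elim, simp)
  moreover have "p_exceptional M p {(\<gamma>, l). arc_length_curve \<gamma> l \<and>
     \<not> ext_dist (f (\<gamma> 0)) (f (\<gamma> l)) \<le> line_integral h \<gamma> l}"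
    using h(2) by (simp add: weak_upper_gradient_def)
  ultimately have "h' \<in> borel_wug M p f"
    using h'(1) hM(2)
  proof (intro borel_wugI[OF M])
    fix \<gamma> l assume "arc_length_curve \<gamma> l" "(\<gamma>, l) \<notin> {(\<gamma>, l). arc_length_curve \<gamma> l \<and>
       \<not> ext_dist (f (\<gamma> 0)) (f (\<gamma> l)) \<le> line_integral h \<gamma> l}"
    then show "ext_dist (f (\<gamma> 0)) (f (\<gamma> l)) \<le> line_integral h' \<gamma> l"
      using line_integral_mono[of h h' \<gamma> l, OF h'(2)] by (auto intro: order_trans)
  qed auto
  then show ?thesis using that h'(3) by blast
qed

text \<open>The limit \<open>g\<close> of the running minima attains the least energy in the class.
  For a competitor \<open>h'\<close>, the function \<open>min g h'\<close> is in the class too, so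
  its energy is not smaller; being pointwise at most \<open>g\<close> and of finite energy, it
  equals \<open>g\<close> almost everywhere, that is, \<open>g \<le> h'\<close> a.e.\<close>

lemma minimal_weak_upper_gradient_exists:
  fixes M :: "'a::metric_space measure"
  assumes M: "metric_measure_space M" and p: "0 < p" and ne: "borel_wug M p f \<noteq> {}"
  shows "\<exists>g. is_minimal_weak_upper_gradient M p f g"
proof -
  define S where "S = borel_wug M p f"
  let ?N = "\<lambda>g. \<integral>\<^sup>+x. enn_powr (g x) p \<partial>M"
  obtain k :: "nat \<Rightarrow> ennreal" where k: "range k \<subseteq> ?N ` S" "Inf (?N ` S) = (INF n. k n)"
    using ennreal_Inf_countable_INF[of "?N ` S"] ne by (auto simp: S_def)
  have "\<exists>g. g \<in> S \<and> ?N g = k n" for n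
  proof -
    have "k n \<in> ?N ` S" using k(1) by blast
    then show ?thesis by auto
  qed
  then obtain gs where gs: "\<And>n. gs n \<in> S" "\<And>n. ?N (gs n) = k n" by metis
  define G where "G = rec_nat (gs 0) (\<lambda>n g x. min (g x) (gs (Suc n) x))"
  have G0: "G 0 = gs 0" and GS: "G (Suc n) = (\<lambda>x. min (G n x) (gs (Suc n) x))" for n
    by (auto simp: G_def)
  have G: "G n \<in> S" for n
    by (induction n) (use gs borel_wug_min[OF M p] in \<open>auto simp: G0 GS S_def\<close>)
  define g where "g x = (INF n. G n x)" for x
  have gS: "g \<in> S"
    unfolding g_def S_def by (rule borel_wug_INF[OF M p]) (use G in \<open>auto simp: S_def GS\<close>)
  have "?N g \<le> k n" for n
  proof -
    have "G n x \<le> gs n x" for x by (cases n) (auto simp: G0 GS)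
    then have "?N g \<le> ?N (gs n)"
      unfolding g_def using p by (intro nn_integral_mono enn_powr_mono INF_lower2) auto
    then show ?thesis by (simp add: gs)
  qed
  then have gI: "?N g \<le> Inf (?N ` S)" unfolding k(2) by (intro INF_greatest)
  have S: "h \<in> borel_measurable M" "?N h < \<infinity>" "weak_upper_gradient M p f h" if "h \<in> S" for h
    using that mms_borel_measurable[OF M] by (auto simp: S_def borel_wug_def)
  have "AE x in M. g x \<le> h x" if h: "h \<in> Lp_nonneg M p" "weak_upper_gradient M p f h" for h
  proof -
    obtain h' where h': "h' \<in> S" "AE x in M. h' x = h x"
      using borel_wug_majorant[OF M h] unfolding S_def by blast
    have mS: "(\<lambda>x. min (g x) (h' x)) \<in> S"
      using borel_wug_min[OF M p] gS h'(1) by (simp add: S_def)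
    let ?a = "\<lambda>x. enn_powr (g x) p" and ?b = "\<lambda>x. enn_powr (min (g x) (h' x)) p"
    have [measurable]: "g \<in> borel_measurable M" "(\<lambda>x. min (g x) (h' x)) \<in> borel_measurable M"
      using S(1) gS mS by auto
    have le: "?b x \<le> ?a x" for x using p by (intro enn_powr_mono) auto
    have "integral\<^sup>N M ?a \<le> integral\<^sup>N M ?b"
      using gI INF_lower[OF mS, of ?N] by simp
    moreover have "(\<integral>\<^sup>+x. ?a x - ?b x \<partial>M) = integral\<^sup>N M ?a - integral\<^sup>N M ?b"
      by (rule nn_integral_diff) (use S(2)[OF mS] le in auto)
    ultimately have "(\<integral>\<^sup>+x. ?a x - ?b x \<partial>M) = 0"
      using S(2)[OF gS] by (simp add: diff_eq_0_iff_ennreal)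
    then have "AE x in M. ?a x - ?b x = 0"
      by (subst (asm) nn_integral_0_iff_AE) measurable
    moreover have "AE x in M. ?b x \<noteq> \<infinity>"
      by (rule nn_integral_noteq_infinite) (use S(2)[OF mS] in auto)
    ultimately show ?thesis using h'(2)
    proof eventually_elim
      case (elim x)
      then have "?a x \<le> ?b x" by (auto simp: diff_eq_0_iff_ennreal)
      then have "g x \<le> min (g x) (h' x)" using p by (rule_tac enn_powr_le_cancel)
      then show ?case using elim(3) by simp
    qed
  qed
  then show ?thesis
    using S[OF gS] by (auto simp: is_minimal_weak_upper_gradient_def Lp_nonneg_def)
qed

lemma minimal_weak_upper_gradient:
  assumes "metric_measure_space M" "0 < p" "borel_wug M p f \<noteq> {}"
  shows "is_minimal_weak_upper_gradient M p f (minimal_weak_upper_gradient M p f)"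
  unfolding minimal_weak_upper_gradient_def
  by (rule someI_ex[OF minimal_weak_upper_gradient_exists[OF assms]])

subsection \<open>Doubling\<close>

lemma mms_measure_ball:
  assumes "metric_measure_space M" "0 < r"
  shows "emeasure M (ball x r) = ennreal (measure M (ball x r))" "0 < measure M (ball x r)"
proof -
  have e: "0 < emeasure M (ball x r)" "emeasure M (ball x r) < \<infinity>"
    using assms by (auto simp: metric_measure_space_def)
  then show "emeasure M (ball x r) = ennreal (measure M (ball x r))"
    by (intro emeasure_eq_ennreal_measure) auto
  then show "0 < measure M (ball x r)" using e by simp
qed

lemma mms_fmeasurable_ball:
  assumes "metric_measure_space M" "0 < r"
  shows "ball x r \<in> fmeasurable M"
  using assms by (intro fmeasurableI mms_ball) (auto simp: metric_measure_space_def)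

lemma annular_decay_1E:
  assumes "annular_decay_1 M"
  obtains C where "1 \<le> C" "\<And>x r R. 0 < r \<Longrightarrow> r < R \<Longrightarrow>
    measure M (ball x R - ball x r) \<le> C * (1 - r / R) * measure M (ball x R)"
proof -
  obtain C where C: "\<And>x r R. 0 < r \<Longrightarrow> r < R \<Longrightarrow>
    measure M (ball x R - ball x r) \<le> C * (1 - r / R) * measure M (ball x R)"
    using assms unfolding annular_decay_1_def by blast
  show ?thesis
  proof (rule that[of "max 1 C"])
    fix x and r R :: real assume r: "0 < r" "r < R"
    have "C * (1 - r / R) * measure M (ball x R) \<le> max 1 C * (1 - r / R) * measure M (ball x R)"
      using r by (intro mult_right_mono) auto
    then show "measure M (ball x R - ball x r) \<le> max 1 C * (1 - r / R) * measure M (ball x R)"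
      using C[OF r] by (rule order_trans[rotated])
  qed simp
qed

text \<open>A ratio \<open>\<theta>\<close> close to 1 makes the annulus carry at most half of the
  ball, so shrinking by \<open>\<theta>\<close> costs at most a factor 2. Iteration reaches any
  ratio \<open>\<kappa>\<close>.\<close>

lemma annular_decay_doubling:
  fixes M :: "'a::metric_space measure"
  assumes M: "metric_measure_space M" and ad: "annular_decay_1 M" and \<kappa>: "0 < \<kappa>"
  obtains D where "1 \<le> D"
    "\<And>x R. 0 < R \<Longrightarrow> measure M (ball x R) \<le> D * measure M (ball x (\<kappa> * R))"
proof -
  obtain C where C: "1 \<le> C" "\<And>x r R. 0 < r \<Longrightarrow> r < R \<Longrightarrow>
    measure M (ball x R - ball x r) \<le> C * (1 - r / R) * measure M (ball x R)"
    using annular_decay_1E[OF ad] by blast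
  \<comment> \<open>Chosen so that \<open>C * (1 - \<theta>) = 1/2\<close>.\<close>
  define \<theta> where "\<theta> = 1 - 1 / (2 * C)"
  have \<theta>: "0 < \<theta>" "\<theta> < 1" using C(1) by (auto simp: \<theta>_def field_simps)
  have half: "measure M (ball x R) \<le> 2 * measure M (ball x (\<theta> * R))" if "0 < R" for x :: 'a and R
  proof -
    have R: "0 < \<theta> * R" "\<theta> * R < R" using \<theta> that by auto
    have "measure M (ball x R - ball x (\<theta> * R)) \<le> C * (1 - \<theta> * R / R) * measure M (ball x R)"
      using C(2)[OF R] .
    also have "C * (1 - \<theta> * R / R) = 1 / 2" using C(1) that by (simp add: \<theta>_def)
    finally have "measure M (ball x R - ball x (\<theta> * R)) \<le> 1 / 2 * measure M (ball x R)" .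
    moreover have "measure M (ball x R - ball x (\<theta> * R)) = measure M (ball x R) - measure M (ball x (\<theta> * R))"
      using R that subset_ball[of "\<theta> * R" R x] M
      by (intro measure_Diff mms_ball) (auto simp: metric_measure_space_def less_top)
    ultimately show ?thesis by simp
  qed
  have iter: "measure M (ball x R) \<le> 2 ^ n * measure M (ball x (\<theta> ^ n * R))" if "0 < R" for x :: 'a and R n
  proof (induction n)
    case (Suc n)
    have "2 ^ n * measure M (ball x (\<theta> ^ n * R)) \<le> 2 ^ n * (2 * measure M (ball x (\<theta> * (\<theta> ^ n * R))))"
      using half[of "\<theta> ^ n * R" x] \<theta> that by (intro mult_left_mono) auto
    then have "measure M (ball x R) \<le> 2 ^ n * (2 * measure M (ball x (\<theta> * (\<theta> ^ n * R))))"
      using Suc by (rule order_trans[rotated])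
    then show ?case by (simp add: mult_ac)
  qed simp
  obtain n where n: "\<theta> ^ n < \<kappa>" using real_arch_pow_inv[OF \<kappa> \<theta>(2)] by blast
  show ?thesis
  proof (rule that[of "2 ^ n"])
    fix x :: 'a and R :: real assume R: "0 < R"
    have "\<theta> ^ n * R \<le> \<kappa> * R" using n R by simp
    then have "measure M (ball x (\<theta> ^ n * R)) \<le> measure M (ball x (\<kappa> * R))"
      using R \<kappa> by (intro measure_mono_fmeasurable subset_ball mms_fmeasurable_ball[OF M] mms_ball[OF M]) auto
    then show "measure M (ball x R) \<le> 2 ^ n * measure M (ball x (\<kappa> * R))"
      using iter[OF R, of x n] by (meson mult_left_mono order_trans zero_le_numeral zero_le_power)
  qed simp
qed

subsection \<open>Upper bound\<close>

text \<open>\<open>newtonian_norm\<close> is an infimum over genuine upper gradients, so no curve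
  may be discarded here. Finiteness of all line integrals takes the place of an exceptional
  family.\<close>

lemma upper_gradient_restrict:
  fixes g :: "'a::metric_space \<Rightarrow> ennreal"
  assumes ug: "upper_gradient f g"
    and fin: "\<And>\<gamma> l. arc_length_curve \<gamma> l \<Longrightarrow> line_integral g \<gamma> l < \<infinity>"
    and E: "E \<in> sets borel" "\<And>x. x \<in> E \<Longrightarrow> f x = ereal c"
  shows "upper_gradient f (\<lambda>x. g x * indicator (- E) x)"
  unfolding upper_gradient_def
proof (intro conjI allI impI)
  have g[measurable]: "g \<in> borel_measurable borel" "E \<in> sets borel"
    using ug E by (auto simp: upper_gradient_def)
  show "(\<lambda>x. g x * indicator (- E) x) \<in> borel_measurable borel" by measurable
  fix \<gamma> :: "real \<Rightarrow> 'a" and l assume \<gamma>: "arc_length_curve \<gamma> l"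
  have "curve_bound f g \<gamma> l"
  proof (rule curve_boundI[OF \<gamma> g(1) fin[OF \<gamma>]])
    fix a b :: real assume "0 \<le> a" "a < b" "b \<le> l"
    then have "arc_length_curve (\<lambda>t. \<gamma> (a + t)) (b - a)" by (rule arc_length_curve_sub[OF \<gamma>])
    then show "ext_dist (f (\<gamma> a)) (f (\<gamma> b)) \<le> line_integral g (\<lambda>t. \<gamma> (a + t)) (b - a)"
      using ug unfolding upper_gradient_def by fastforce
  qed
  then show "ext_dist (f (\<gamma> 0)) (f (\<gamma> l)) \<le> line_integral (\<lambda>x. g x * indicator (- E) x) \<gamma> l"
    by (rule curve_bound_restrict[OF \<gamma> g(1)]) (rule E(2))
qed

lemma line_integral_const: "0 \<le> l \<Longrightarrow> line_integral (\<lambda>_. c) \<gamma> l = c * ennreal l"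
  unfolding line_integral_lborel by (simp add: nn_integral_cmult)

definition cutoff :: "'a::metric_space \<Rightarrow> real \<Rightarrow> real \<Rightarrow> 'a \<Rightarrow> real" where
  "cutoff x0 r R x = max 0 (min 1 ((R - dist x0 x) / (R - r)))"

lemma cutoff_lipschitz:
  assumes "r < R"
  shows "\<bar>cutoff x0 r R x - cutoff x0 r R y\<bar> \<le> 1 / (R - r) * dist x y"
proof -
  have clamp: "\<bar>max 0 (min 1 a) - max 0 (min 1 b)\<bar> \<le> \<bar>a - b\<bar>" for a b :: real by auto
  have "\<bar>cutoff x0 r R x - cutoff x0 r R y\<bar> \<le> \<bar>(R - dist x0 x) / (R - r) - (R - dist x0 y) / (R - r)\<bar>"
    unfolding cutoff_def by (rule clamp)
  also have "\<dots> = \<bar>dist x0 y - dist x0 x\<bar> / (R - r)"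
    using assms by (simp add: diff_divide_distrib[symmetric] abs_divide)
  also have "\<dots> \<le> dist x y / (R - r)"
    using assms abs_dist_diff_le[of y x0 x] by (intro divide_right_mono) (auto simp: dist_commute)
  finally show ?thesis by simp
qed

text \<open>The Lipschitz constant is an upper gradient because arc length dominates distance. It is
  cut down to the annulus in two steps, on the sets where the cutoff equals 1 and 0.\<close>

lemma cutoff_upper_gradient:
  assumes rR: "r < R"
  shows "upper_gradient (\<lambda>x. ereal (cutoff x0 r R x)) (\<lambda>x. ennreal (1 / (R - r)) * indicator (ball x0 R - ball x0 r) x)"
    (is "upper_gradient ?f _")
proof -
  let ?k = "ennreal (1 / (R - r))"
  have const: "upper_gradient ?f (\<lambda>_. ?k)"
    unfolding upper_gradient_def
  proof (intro conjI allI impI)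
    fix \<gamma> :: "real \<Rightarrow> 'a" and l assume \<gamma>: "arc_length_curve \<gamma> l"
    then have l: "0 < l" by (simp add: arc_length_curve_def)
    have "\<bar>cutoff x0 r R (\<gamma> 0) - cutoff x0 r R (\<gamma> l)\<bar> \<le> 1 / (R - r) * dist (\<gamma> 0) (\<gamma> l)"
      using rR by (rule cutoff_lipschitz)
    also have "\<dots> \<le> 1 / (R - r) * l"
      using arc_length_curve_dist[OF \<gamma>, of 0 l] l rR by (intro mult_left_mono) auto
    finally show "ext_dist (?f (\<gamma> 0)) (?f (\<gamma> l)) \<le> line_integral (\<lambda>_. ?k) \<gamma> l"
      using l rR by (simp add: ext_dist_ereal line_integral_const ennreal_mult[symmetric] ennreal_leI)
  qed simp
  have fin: "line_integral g \<gamma> l < \<infinity>" if "arc_length_curve \<gamma> l" "\<And>x. g x \<le> ?k" for \<gamma> :: "real \<Rightarrow> 'a" and l g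
  proof -
    have "line_integral g \<gamma> l \<le> line_integral (\<lambda>_. ?k) \<gamma> l" using that(2) by (rule line_integral_mono)
    also have "\<dots> < \<infinity>" using that(1)
      by (simp add: line_integral_const arc_length_curve_def ennreal_mult_less_top)
    finally show ?thesis .
  qed
  have one: "?f x = ereal 1" if "x \<in> ball x0 r" for x
    using that rR by (simp add: cutoff_def field_simps)
  have zero: "?f x = ereal 0" if "x \<in> - ball x0 R" for x
    using that rR by (simp add: cutoff_def zero_le_divide_iff max_def)
  have "upper_gradient ?f (\<lambda>x. ?k * indicator (- ball x0 r) x)"
    by (rule upper_gradient_restrict[OF const fin _ one]) auto
  then have "upper_gradient ?f (\<lambda>x. ?k * indicator (- ball x0 r) x * indicator (- (- ball x0 R)) x)"
    by (rule upper_gradient_restrict[OF _ fin _ zero]) (auto split: split_indicator)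
  moreover have "(\<lambda>x. ?k * indicator (- ball x0 r) x * indicator (- (- ball x0 R)) x)
     = (\<lambda>x. ?k * indicator (ball x0 R - ball x0 r) x)"
    by (rule ext) (simp split: split_indicator)
  ultimately show ?thesis by simp
qed

text \<open>Minimality gives that \<open>g_u\<close> of the cutoff is a.e. at most the explicit
  gradient, whose energy is the right side.\<close>

lemma var_cap_ball_le:
  fixes M :: "'a::metric_space measure"
  assumes M: "metric_measure_space M" and p: "1 \<le> p" and r: "0 < r" "r < R"
  shows "var_cap M p (ball x0 r) (ball x0 R)
    \<le> ennreal ((1 / (R - r)) powr p * measure M (ball x0 R - ball x0 r))"
proof -
  let ?f = "\<lambda>x. ereal (cutoff x0 r R x)"
  define g where "g x = ennreal (1 / (R - r)) * indicator (ball x0 R - ball x0 r) x" for x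
  let ?A = "ball x0 R - ball x0 r"
  have A: "?A \<in> sets M" using mms_ball[OF M] by auto
  have ug: "upper_gradient ?f g" unfolding g_def by (rule cutoff_upper_gradient[OF r(2)])
  have gp: "enn_powr (g x) p = ennreal ((1 / (R - r)) powr p) * indicator ?A x" for x
    using r by (auto simp: g_def enn_powr_0 enn_powr_ennreal split: split_indicator)
  have Afin: "emeasure M ?A = ennreal (measure M ?A)"
  proof -
    have "emeasure M ?A \<le> emeasure M (ball x0 R)"
      using mms_ball[OF M] by (intro emeasure_mono) auto
    then have "emeasure M ?A \<noteq> \<infinity>"
      using mms_measure_ball(1)[OF M, of R x0] r by (auto simp: top_unique)
    then show ?thesis by (intro emeasure_eq_ennreal_measure) auto
  qed
  have gN: "(\<integral>\<^sup>+x. enn_powr (g x) p \<partial>M) = ennreal ((1 / (R - r)) powr p * measure M ?A)"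
    unfolding gp using A by (simp add: nn_integral_cmult_indicator Afin ennreal_mult)
  have u: "0 \<le> cutoff x0 r R x" "cutoff x0 r R x \<le> 1" for x by (auto simp: cutoff_def)
  have u0: "cutoff x0 r R x = 0" if "x \<notin> ball x0 R" for x
    using that r by (simp add: cutoff_def zero_le_divide_iff max_def)
  have u1: "cutoff x0 r R x = 1" if "x \<in> ball x0 r" for x
    using that r by (simp add: cutoff_def field_simps)
  have "?f \<in> newtonian_space M p"
  proof -
    have [measurable]: "dist x0 \<in> borel_measurable borel"
      by (intro borel_measurable_continuous_onI continuous_intros)
    have "?f \<in> borel_measurable borel" unfolding cutoff_def by measurable
    then have fm: "?f \<in> borel_measurable M" by (rule mms_borel_measurable[OF M])
    have "(\<integral>\<^sup>+x. enn_powr (e2ennreal \<bar>?f x\<bar>) p \<partial>M) \<le> (\<integral>\<^sup>+x. indicator (ball x0 R) x \<partial>M)"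
    proof (intro nn_integral_mono)
      fix x
      show "enn_powr (e2ennreal \<bar>?f x\<bar>) p \<le> indicator (ball x0 R) x"
      proof (cases "x \<in> ball x0 R")
        case True
        have "cutoff x0 r R x powr p \<le> 1" using u p by (intro powr_le1) auto
        then show ?thesis using True u by (simp add: enn_powr_ennreal)
      qed (simp add: u0 enn_powr_0)
    qed
    also have "\<dots> < \<infinity>"
      using mms_measure_ball(1)[OF M, of R x0] r mms_ball[OF M, of x0 R] by simp
    finally have 1: "(\<integral>\<^sup>+x. enn_powr (e2ennreal \<bar>?f x\<bar>) p \<partial>M) < \<infinity>" .
    have "(INF g \<in> {g. upper_gradient ?f g}. \<integral>\<^sup>+x. enn_powr (g x) p \<partial>M) \<le> (\<integral>\<^sup>+x. enn_powr (g x) p \<partial>M)"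
      using ug by (intro INF_lower) auto
    then have 2: "(INF g \<in> {g. upper_gradient ?f g}. \<integral>\<^sup>+x. enn_powr (g x) p \<partial>M) < \<infinity>"
      unfolding gN by (simp add: le_less_trans)
    have "(\<integral>\<^sup>+x. enn_powr (e2ennreal \<bar>?f x\<bar>) p \<partial>M) +
        (INF g \<in> {g. upper_gradient ?f g}. \<integral>\<^sup>+x. enn_powr (g x) p \<partial>M) < \<infinity>" (is "?s < _")
      using 1 2 by (simp only: infinity_ennreal_def ennreal_add_less_top)
    then have "enn_powr ?s (1 / p) < \<infinity>" by (simp only: enn_powr_less_top)
    then show ?thesis
      unfolding newtonian_space_def newtonian_norm_def mem_Collect_eq using fm by (intro conjI)
  qed
  then have "var_cap M p (ball x0 r) (ball x0 R)
      \<le> (\<integral>\<^sup>+x\<in>ball x0 R. enn_powr (minimal_weak_upper_gradient M p ?f x) p \<partial>M)"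
    unfolding var_cap_def using u u0 u1
    by (intro INF_lower) (auto simp: indicator_def)
  also have "\<dots> \<le> (\<integral>\<^sup>+x. enn_powr (g x) p \<partial>M)"
  proof -
    have gw: "g \<in> borel_wug M p ?f"
      using ug gN by (intro upper_gradient_borel_wug[OF M]) auto
    have "is_minimal_weak_upper_gradient M p ?f (minimal_weak_upper_gradient M p ?f)"
      using gw p by (intro minimal_weak_upper_gradient[OF M]) auto
    then have "AE x in M. minimal_weak_upper_gradient M p ?f x \<le> g x"
      using gw mms_borel_measurable[OF M]
      unfolding is_minimal_weak_upper_gradient_def borel_wug_def Lp_nonneg_def by blast
    then show ?thesis
    proof (intro nn_integral_mono_AE, eventually_elim)
      case (elim x)
      then have "enn_powr (minimal_weak_upper_gradient M p ?f x) p \<le> enn_powr (g x) p"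
        using p by (intro enn_powr_mono) auto
      then show ?case by (auto split: split_indicator)
    qed
  qed
  finally show ?thesis unfolding gN .
qed

subsection \<open>Lower bound\<close>

lemma e2ennreal_01: "e2ennreal 0 = 0" "e2ennreal 1 = 1"
  by (simp_all add: one_ereal_def zero_ereal_def)

text \<open>Whatever \<open>m\<close> is, \<open>\<bar>1 - m\<bar> + \<bar>m\<bar> \<ge> 1\<close>,
  so two sets of measure at least \<open>c\<close> on which \<open>f\<close> differs by 1 suffice;
  the mean value need not be computed.\<close>

lemma oscillation_ge:
  fixes M :: "'a::metric_space measure" and f :: "'a \<Rightarrow> ereal"
  assumes S: "S1 \<in> sets M" "S2 \<in> sets M" "S1 \<inter> S2 = {}" "S1 \<subseteq> B" "S2 \<subseteq> B"
    and f: "\<And>x. x \<in> S1 \<Longrightarrow> f x = 1" "\<And>x. x \<in> S2 \<Longrightarrow> f x = 0"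
    and c: "c \<le> emeasure M S1" "c \<le> emeasure M S2"
  shows "c \<le> (\<integral>\<^sup>+y\<in>B. e2ennreal \<bar>f y - ereal m\<bar> \<partial>M)"
proof -
  have "c = ennreal 1 * c" by simp
  also have "\<dots> \<le> (ennreal \<bar>1 - m\<bar> + ennreal \<bar>m\<bar>) * c"
    by (intro mult_right_mono) (auto simp: ennreal_plus[symmetric] simp del: ennreal_plus intro!: ennreal_leI)
  also have "\<dots> = ennreal \<bar>1 - m\<bar> * c + ennreal \<bar>m\<bar> * c"
    by (simp add: distrib_right)
  also have "\<dots> \<le> ennreal \<bar>1 - m\<bar> * emeasure M S1 + ennreal \<bar>m\<bar> * emeasure M S2"
    using c by (intro add_mono mult_left_mono) auto
  also have "\<dots> = (\<integral>\<^sup>+y. ennreal \<bar>1 - m\<bar> * indicator S1 y + ennreal \<bar>m\<bar> * indicator S2 y \<partial>M)"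
    using S by (subst nn_integral_add) (auto simp: nn_integral_cmult_indicator)
  also have "\<dots> \<le> (\<integral>\<^sup>+y\<in>B. e2ennreal \<bar>f y - ereal m\<bar> \<partial>M)"
  proof (intro nn_integral_mono)
    fix y
    consider "y \<in> S1" "y \<notin> S2" | "y \<in> S2" "y \<notin> S1" | "y \<notin> S1" "y \<notin> S2" using S by blast
    then show "ennreal \<bar>1 - m\<bar> * indicator S1 y + ennreal \<bar>m\<bar> * indicator S2 y
        \<le> e2ennreal \<bar>f y - ereal m\<bar> * indicator B y"
    proof cases
      case 1
      have "\<bar>f y - ereal m\<bar> = ereal \<bar>1 - m\<bar>" using f(1)[OF 1(1)] by (simp add: one_ereal_def)
      then show ?thesis using 1 S by auto
    next
      case 2
      have "\<bar>f y - ereal m\<bar> = ereal \<bar>m\<bar>" using f(2)[OF 2(1)] by (simp add: zero_ereal_def)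
      then show ?thesis using 2 S by auto
    qed simp
  qed
  finally show ?thesis .
qed

text \<open>The Poincare inequality with averages replaced by integrals, which is weaker but suits
  sets whose measure is bounded below.\<close>

definition poincare_bound :: "'a::metric_space measure \<Rightarrow> real \<Rightarrow> real \<Rightarrow> bool" where
  "poincare_bound M C \<Lambda> \<longleftrightarrow> (\<forall>x r f g. 0 < r \<longrightarrow> f \<in> borel_measurable M \<longrightarrow>
     (\<integral>\<^sup>+y. e2ennreal \<bar>f y\<bar> \<partial>M) < \<infinity> \<longrightarrow> upper_gradient f g \<longrightarrow>
     (\<integral>\<^sup>+y\<in>ball x r. e2ennreal \<bar>f y - ereal (mean_value M (ball x r) f)\<bar> \<partial>M)
       \<le> ennreal (C * r) * (\<integral>\<^sup>+y\<in>ball x (\<Lambda> * r). g y \<partial>M))"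

text \<open>The inequality is multiplied by the measure of \<open>ball x r\<close>, which is at most
  that of \<open>ball x (\<Lambda> * r)\<close>.\<close>

lemma poincare_1E:
  fixes M :: "'a::metric_space measure"
  assumes M: "metric_measure_space M" and "poincare_1 M"
  obtains C \<Lambda> where "0 < C" "1 \<le> \<Lambda>" "poincare_bound M C \<Lambda>"
proof -
  obtain C \<Lambda> where C: "0 < C" "1 \<le> \<Lambda>" and P: "\<And>x r f g. 0 < r \<Longrightarrow> f \<in> borel_measurable M \<Longrightarrow>
      (\<integral>\<^sup>+y. e2ennreal \<bar>f y\<bar> \<partial>M) < \<infinity> \<Longrightarrow> upper_gradient f g \<Longrightarrow>
      (\<integral>\<^sup>+y\<in>ball x r. e2ennreal \<bar>f y - ereal (mean_value M (ball x r) f)\<bar> \<partial>M) / emeasure M (ball x r)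
        \<le> ennreal (C * r) * ((\<integral>\<^sup>+y\<in>ball x (\<Lambda> * r). g y \<partial>M) / emeasure M (ball x (\<Lambda> * r)))"
    using assms(2) unfolding poincare_1_def by blast
  show ?thesis
  proof (rule that[OF C], unfold poincare_bound_def, intro allI impI)
    fix x :: 'a and r :: real and f g
    assume *: "0 < r" "f \<in> borel_measurable M" "(\<integral>\<^sup>+y. e2ennreal \<bar>f y\<bar> \<partial>M) < \<infinity>" "upper_gradient f g"
    let ?I = "\<integral>\<^sup>+y\<in>ball x r. e2ennreal \<bar>f y - ereal (mean_value M (ball x r) f)\<bar> \<partial>M"
    let ?Y = "\<integral>\<^sup>+y\<in>ball x (\<Lambda> * r). g y \<partial>M"
    let ?b = "emeasure M (ball x r)" and ?b' = "emeasure M (ball x (\<Lambda> * r))"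
    have b: "?b \<noteq> 0" "?b \<noteq> \<infinity>" "?b' \<noteq> 0" "?b' \<noteq> \<infinity>"
      using mms_measure_ball[OF M, of r x] mms_measure_ball[OF M, of "\<Lambda> * r" x] *(1) C by auto
    have "r \<le> \<Lambda> * r" using * C by simp
    then have bb: "?b \<le> ?b'" by (intro emeasure_mono subset_ball mms_ball[OF M])
    have "?I = ?I / ?b * ?b" using b by (simp add: ennreal_divide_times ennreal_divide_self less_top)
    also have "\<dots> \<le> ennreal (C * r) * (?Y / ?b') * ?b'"
      by (intro mult_mono P[OF *] bb) auto
    also have "\<dots> = ennreal (C * r) * ?Y" using b by (simp add: mult.assoc ennreal_divide_times ennreal_divide_self less_top)
    finally show "?I \<le> ennreal (C * r) * ?Y" .
  qed
qed

text \<open>Otherwise the indicator of the ball has the upper gradient \<open>0\<close>.\<close>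

lemma poincare_shell_nonempty:
  fixes M :: "'a::metric_space measure" and x0 z :: 'a
  assumes M: "metric_measure_space M" and P: "poincare_1 M"
    and ab: "0 < a" "a < b" "b \<le> dist x0 z"
  obtains y where "a \<le> dist x0 y" "dist x0 y < b"
proof (rule ccontr)
  assume "\<not> thesis"
  then have gap: "dist x0 y < a \<or> b \<le> dist x0 y" for y using that by (meson not_le)
  obtain C \<Lambda> where P: "poincare_bound M C \<Lambda>" by (rule poincare_1E[OF M P])
  define f :: "'a \<Rightarrow> ereal" where "f = indicator (ball x0 a)"
  have fm: "f \<in> borel_measurable M" unfolding f_def using mms_ball[OF M] by simp
  have "(\<integral>\<^sup>+y. e2ennreal \<bar>f y\<bar> \<partial>M) = (\<integral>\<^sup>+y. indicator (ball x0 a) y \<partial>M)"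
    by (intro nn_integral_cong) (simp add: f_def e2ennreal_01 split: split_indicator)
  also have "\<dots> < \<infinity>"
    using mms_measure_ball(1)[OF M ab(1), of x0] mms_ball[OF M, of x0 a] by simp
  finally have fi: "(\<integral>\<^sup>+y. e2ennreal \<bar>f y\<bar> \<partial>M) < \<infinity>" .
  have ug: "upper_gradient f (\<lambda>_. 0)"
    unfolding upper_gradient_def
  proof (intro conjI allI impI)
    fix \<gamma> :: "real \<Rightarrow> 'a" and l assume "arc_length_curve \<gamma> l"
    then have l: "0 < l" "continuous_on {0..l} \<gamma>" by (auto simp: arc_length_curve_def)
    have cont: "continuous_on {0..l} (\<lambda>t. dist x0 (\<gamma> t))" using l by (intro continuous_intros)
    \<comment> \<open>By the intermediate value theorem a curve leaving or entering the ball would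
      meet the sphere of radius \<open>a\<close>, which lies in the empty shell.\<close>
    have "dist x0 (\<gamma> 0) < a \<longleftrightarrow> dist x0 (\<gamma> l) < a"
    proof (rule ccontr)
      assume "\<not> ?thesis"
      then consider "dist x0 (\<gamma> 0) \<le> a" "a \<le> dist x0 (\<gamma> l)" | "dist x0 (\<gamma> l) \<le> a" "a \<le> dist x0 (\<gamma> 0)"
        by linarith
      then have "\<exists>t\<ge>0. t \<le> l \<and> dist x0 (\<gamma> t) = a"
      proof cases
        case 1
        then show ?thesis using IVT'[OF _ _ _ cont] l(1) by simp
      next
        case 2
        then show ?thesis using IVT2'[OF _ _ _ cont] l(1) by simp
      qed
      then obtain t where "dist x0 (\<gamma> t) = a" by blast
      then show False using gap[of "\<gamma> t"] ab(2) by simp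
    qed
    then have "f (\<gamma> 0) = f (\<gamma> l)" by (simp add: f_def indicator_def)
    moreover have "\<bar>f (\<gamma> l)\<bar> \<noteq> \<infinity>" by (simp add: f_def indicator_def)
    ultimately show "ext_dist (f (\<gamma> 0)) (f (\<gamma> l)) \<le> line_integral (\<lambda>_. 0) \<gamma> l"
      by (auto simp: ext_dist_def e2ennreal_01)
  qed simp
  \<comment> \<open>A ball around \<open>z\<close> of this radius stays at distance more than
    \<open>a\<close> from \<open>x0\<close>, so \<open>f = 0\<close> on it; \<open>r\<close> is
    large enough to contain both balls.\<close>
  define S where "S = ball z (b - a)"
  define r where "r = dist x0 z + b"
  have r: "0 < r" using ab by (simp add: r_def add_pos_nonneg)
  define c where "c = min (emeasure M (ball x0 a)) (emeasure M S)"
  have S: "a < dist x0 y" "dist x0 y < r" if "y \<in> S" for y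
    using that ab dist_triangle[of x0 z y] dist_triangle[of x0 y z]
    by (auto simp: S_def r_def dist_commute)
  have "c \<le> (\<integral>\<^sup>+y\<in>ball x0 r. e2ennreal \<bar>f y - ereal (mean_value M (ball x0 r) f)\<bar> \<partial>M)"
  proof (rule oscillation_ge[of "ball x0 a" M S])
    show "ball x0 a \<subseteq> ball x0 r" using ab by (intro subset_ball) (simp add: r_def)
    show "ball x0 a \<inter> S = {}" using S by fastforce
    show "S \<subseteq> ball x0 r" using S by auto
    show "f x = 0" if "x \<in> S" for x using S[OF that] by (simp add: f_def)
  qed (auto simp: mms_ball[OF M] S_def f_def c_def)
  also have "\<dots> \<le> ennreal (C * r) * (\<integral>\<^sup>+y\<in>ball x0 (\<Lambda> * r). 0 \<partial>M)"
    using P r fm fi ug unfolding poincare_bound_def by blast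
  finally have "c = 0" by simp
  moreover have "0 < c"
    using M ab unfolding c_def S_def by (simp add: metric_measure_space_def)
  ultimately show False by simp
qed

lemma ennreal_le_of_le_add_mult:
  fixes x y z :: ennreal
  assumes "\<And>e. 0 < e \<Longrightarrow> x \<le> y + ennreal e * z" "z < \<infinity>"
  shows "x \<le> y"
proof (rule ennreal_le_epsilon)
  fix e :: real assume e: "0 < e"
  obtain w where w: "z = ennreal w" "0 \<le> w" using assms(2) by (cases z) auto
  have "x \<le> y + ennreal (e / (w + 1)) * z" using e w by (intro assms(1)) auto
  also have "ennreal (e / (w + 1)) * z \<le> ennreal e"
    using e w by (simp add: ennreal_mult[symmetric] divide_le_eq algebra_simps)
  finally show "x \<le> y + ennreal e" by (simp add: add_left_mono)
qed

text \<open>If \<open>\<rho>\<close> has infinite integral along the exceptional curves of \<open>g\<close>, then \<open>max g (e * \<rho>)\<close> is an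
  upper gradient for every \<open>e > 0\<close>.\<close>

lemma poincare_borel_wug:
  fixes M :: "'a::metric_space measure" and f :: "'a \<Rightarrow> ereal"
  assumes M: "metric_measure_space M" and p: "1 \<le> p"
    and g: "g \<in> borel_wug M p f" and Kr: "0 < s"
    and P: "\<And>g. upper_gradient f g \<Longrightarrow> I \<le> ennreal K * (\<integral>\<^sup>+y\<in>ball x s. g y \<partial>M)"
  shows "I \<le> ennreal K * (\<integral>\<^sup>+y. g y \<partial>M)"
proof -
  have gb[measurable]: "g \<in> borel_measurable borel" using g by (simp add: borel_wug_def)
  obtain \<rho> where \<rho>: "\<rho> \<in> borel_measurable borel" "(\<integral>\<^sup>+x. enn_powr (\<rho> x) p \<partial>M) < \<infinity>"
    and \<rho>_top: "\<And>\<gamma> l. (\<gamma>, l) \<in> {(\<gamma>, l). arc_length_curve \<gamma> l \<and>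
       \<not> ext_dist (f (\<gamma> 0)) (f (\<gamma> l)) \<le> line_integral g \<gamma> l} \<Longrightarrow> line_integral \<rho> \<gamma> l = \<infinity>"
    using p_exceptionalE[OF M, of p] g unfolding borel_wug_def weak_upper_gradient_def by blast
  note [measurable] = \<rho>(1)
  have gM[measurable]: "g \<in> borel_measurable M" "\<rho> \<in> borel_measurable M" "ball x s \<in> sets M"
    by (rule mms_borel_measurable[OF M gb] mms_borel_measurable[OF M \<rho>(1)] mms_ball[OF M])+
  have ug: "upper_gradient f (\<lambda>x. max (g x) (ennreal e * \<rho> x))" if e: "0 < e" for e
    unfolding upper_gradient_def
  proof (intro conjI allI impI)
    fix \<gamma> :: "real \<Rightarrow> 'a" and l assume \<gamma>: "arc_length_curve \<gamma> l"
    show "ext_dist (f (\<gamma> 0)) (f (\<gamma> l)) \<le> line_integral (\<lambda>x. max (g x) (ennreal e * \<rho> x)) \<gamma> l"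
    proof (cases "ext_dist (f (\<gamma> 0)) (f (\<gamma> l)) \<le> line_integral g \<gamma> l")
      case True
      then show ?thesis
        by (rule order_trans) (intro line_integral_mono, simp)
    next
      case False
      have "ennreal e * line_integral \<rho> \<gamma> l = line_integral (\<lambda>x. ennreal e * \<rho> x) \<gamma> l"
        by (rule line_integral_cmult[OF \<gamma> \<rho>(1), symmetric])
      also have "\<dots> \<le> line_integral (\<lambda>x. max (g x) (ennreal e * \<rho> x)) \<gamma> l"
        by (intro line_integral_mono) simp
      also have "line_integral \<rho> \<gamma> l = \<infinity>" using \<rho>_top[of \<gamma> l] \<gamma> False by simp
      finally show ?thesis using e by (simp add: ennreal_mult_top top_unique)
    qed
  qed measurable
  \<comment> \<open>The density is in \<open>L^p\<close> and need not be integrable on the whole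
    space, but it is integrable on the ball since \<open>p \<ge> 1\<close>.\<close>
  let ?Z = "\<integral>\<^sup>+y\<in>ball x s. \<rho> y \<partial>M"
  have "?Z \<le> (\<integral>\<^sup>+y. indicator (ball x s) y + enn_powr (\<rho> y) p \<partial>M)"
    using le_one_plus_enn_powr[OF p]
    by (intro nn_integral_mono) (auto split: split_indicator)
  also have "\<dots> = emeasure M (ball x s) + (\<integral>\<^sup>+y. enn_powr (\<rho> y) p \<partial>M)"
    by (subst nn_integral_add) auto
  also have "\<dots> < \<infinity>"
    using \<rho>(2) mms_measure_ball(1)[OF M Kr, of x] by simp
  finally have Z: "?Z < \<infinity>" .
  show ?thesis
  proof (rule ennreal_le_of_le_add_mult)
    fix e :: real assume e: "0 < e"
    have "I \<le> ennreal K * (\<integral>\<^sup>+y\<in>ball x s. max (g y) (ennreal e * \<rho> y) \<partial>M)"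
      by (rule P[OF ug[OF e]])
    \<comment> \<open>The maximum is bounded by the sum; only the \<open>\<rho>\<close> part keeps
      its restriction to the ball, where its integral is finite.\<close>
    also have "\<dots> \<le> ennreal K * (\<integral>\<^sup>+y. g y + ennreal e * (\<rho> y * indicator (ball x s) y) \<partial>M)"
      by (intro mult_left_mono nn_integral_mono) (auto simp: max_def split: split_indicator)
    also have "\<dots> = ennreal K * ((\<integral>\<^sup>+y. g y \<partial>M) + ennreal e * ?Z)"
      by (subst nn_integral_add) (auto simp: nn_integral_cmult)
    also have "\<dots> = ennreal K * (\<integral>\<^sup>+y. g y \<partial>M) + ennreal e * (ennreal K * ?Z)"
      by (simp add: distrib_left mult.left_commute)
    finally show "I \<le> ennreal K * (\<integral>\<^sup>+y. g y \<partial>M) + ennreal e * (ennreal K * ?Z)" .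
  next
    show "ennreal K * ?Z < \<infinity>" using Z by (simp add: ennreal_mult_less_top)
  qed
qed

text \<open>Hoelder's inequality, obtained by integrating the tangent line inequality for \<open>a powr p\<close> at the
  mean value \<open>I / \<alpha>\<close>.\<close>

lemma nn_integral_enn_powr_ge:
  assumes [measurable]: "g \<in> borel_measurable M" and A: "A \<in> sets M" and p: "1 \<le> p"
    and \<alpha>: "emeasure M A \<le> ennreal \<alpha>" "0 < \<alpha>" and I: "ennreal I \<le> (\<integral>\<^sup>+x\<in>A. g x \<partial>M)" "0 < I"
  shows "ennreal (I powr p * \<alpha> powr (1 - p)) \<le> (\<integral>\<^sup>+x\<in>A. enn_powr (g x) p \<partial>M)"
proof (cases "(\<integral>\<^sup>+x\<in>A. enn_powr (g x) p \<partial>M)")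
  case top
  then show ?thesis by simp
next
  case (real J)
  note [measurable] = A
  define s where "s = I / \<alpha>"
  have s: "0 < s" using I \<alpha> by (simp add: s_def)
  have young: "ennreal (p * s powr (p - 1)) * a \<le> enn_powr a p + ennreal ((p - 1) * s powr p)" for a
  proof (cases a)
    case (real b)
    then show ?thesis
      using young_tangent[of b s p] s p
      by (simp add: enn_powr_ennreal ennreal_mult[symmetric] ennreal_plus[symmetric] ennreal_leI del: ennreal_plus)
  qed (simp add: enn_powr_def)
  have "ennreal (p * s powr (p - 1) * I) = ennreal (p * s powr (p - 1)) * ennreal I"
    using p I by (simp add: ennreal_mult)
  also have "\<dots> \<le> ennreal (p * s powr (p - 1)) * (\<integral>\<^sup>+x\<in>A. g x \<partial>M)"
    by (intro mult_left_mono I) simp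
  also have "\<dots> = (\<integral>\<^sup>+x\<in>A. ennreal (p * s powr (p - 1)) * g x \<partial>M)"
    by (simp add: nn_integral_cmult mult.assoc)
  also have "\<dots> \<le> (\<integral>\<^sup>+x. enn_powr (g x) p * indicator A x + ennreal ((p - 1) * s powr p) * indicator A x \<partial>M)"
    using young by (intro nn_integral_mono) (auto split: split_indicator)
  also have "\<dots> = ennreal J + ennreal ((p - 1) * s powr p) * emeasure M A"
    by (subst nn_integral_add) (auto simp: real nn_integral_cmult_indicator)
  also have "\<dots> \<le> ennreal J + ennreal ((p - 1) * s powr p) * ennreal \<alpha>"
    by (intro add_left_mono mult_left_mono \<alpha>) simp
  also have "\<dots> = ennreal (J + (p - 1) * s powr p * \<alpha>)"
    using real p \<alpha> by (simp add: ennreal_mult)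
  finally have *: "p * s powr (p - 1) * I \<le> J + (p - 1) * s powr p * \<alpha>"
    using real p \<alpha> by (subst (asm) ennreal_le_iff) auto
  \<comment> \<open>By \<open>I = s * \<alpha>\<close> both linear terms are multiples of
    \<open>s powr p * \<alpha>\<close>, with the factors \<open>p\<close> and \<open>p - 1\<close>;
    one copy survives.\<close>
  have "s powr (p - 1) * I = s powr p * \<alpha>"
    using s \<alpha> I by (simp add: powr_diff) (simp add: s_def)
  then have eq: "p * s powr (p - 1) * I = p * (s powr p * \<alpha>)" by (simp add: mult.assoc)
  have "s powr p * \<alpha> \<le> J" using *[unfolded eq] by (simp add: algebra_simps)
  moreover have "s powr p * \<alpha> = I powr p * \<alpha> powr (1 - p)"
    using \<alpha> I by (simp add: s_def powr_divide powr_diff)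
  ultimately show ?thesis using real by (simp add: ennreal_leI)
qed

text \<open>Here \<open>c\<close> is a common lower bound for the measures of a ball where
  \<open>u = 1\<close> and one where \<open>u = 0\<close>. The bound \<open>\<alpha>\<close> on the
  annulus is from above because it is raised to \<open>1 - p \<le> 0\<close>.\<close>

lemma var_cap_ball_ge:
  fixes M :: "'a::metric_space measure" and x0 y :: 'a
  assumes M: "metric_measure_space M" and p: "1 \<le> p"
    and P: "poincare_bound M C \<Lambda>" "0 < C" "1 \<le> \<Lambda>"
    and r: "0 < r" "r < R" and s: "0 < s" "R + s \<le> dist x0 y" "dist x0 y + s \<le> 2 * R"
    and c: "0 < c" "c \<le> measure M (ball x0 r)" "c \<le> measure M (ball y s)"
    and \<alpha>: "0 < \<alpha>" "measure M (ball x0 R - ball x0 r) \<le> \<alpha>"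
  shows "ennreal ((c / (C * (2 * R))) powr p * \<alpha> powr (1 - p)) \<le> var_cap M p (ball x0 r) (ball x0 R)"
  unfolding var_cap_def
proof (rule INF_greatest)
  fix u assume "u \<in> {u \<in> newtonian_space M p.
      (\<forall>x\<in>ball x0 R. indicator (ball x0 r) x \<le> u x \<and> u x \<le> 1) \<and> (\<forall>x. x \<notin> ball x0 R \<longrightarrow> u x = 0)}"
  then have uN: "u \<in> newtonian_space M p"
    and uR: "\<And>x. x \<in> ball x0 R \<Longrightarrow> indicator (ball x0 r) x \<le> u x \<and> u x \<le> 1"
    and u0: "\<And>x. x \<notin> ball x0 R \<Longrightarrow> u x = 0" by auto
  have u1: "u x = 1" if "x \<in> ball x0 r" for x
    using uR[of x] that r by (auto intro: antisym)
  have um: "u \<in> borel_measurable M" and "newtonian_norm M p u < \<infinity>"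
    using uN by (auto simp: newtonian_space_def)
  then have "(\<integral>\<^sup>+x. enn_powr (e2ennreal \<bar>u x\<bar>) p \<partial>M) +
      (INF g \<in> {g. upper_gradient u g}. \<integral>\<^sup>+x. enn_powr (g x) p \<partial>M) < \<infinity>"
    unfolding newtonian_norm_def enn_powr_less_top by blast
  then have "(INF g \<in> {g. upper_gradient u g}. \<integral>\<^sup>+x. enn_powr (g x) p \<partial>M) < \<infinity>"
    by (simp only: infinity_ennreal_def ennreal_add_less_top)
  then obtain g0 where "upper_gradient u g0" "(\<integral>\<^sup>+x. enn_powr (g0 x) p \<partial>M) < \<infinity>"
    unfolding INF_less_iff by blast
  then have "borel_wug M p u \<noteq> {}" using upper_gradient_borel_wug[OF M] by blast
  define gu where "gu = minimal_weak_upper_gradient M p u"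
  have "is_minimal_weak_upper_gradient M p u gu"
    unfolding gu_def using p by (intro minimal_weak_upper_gradient[OF M] \<open>borel_wug M p u \<noteq> {}\<close>) auto
  then have gu: "gu \<in> Lp_nonneg M p" "weak_upper_gradient M p u gu"
    by (auto simp: is_minimal_weak_upper_gradient_def)
  have gum: "gu \<in> borel_measurable M" using gu by (simp add: Lp_nonneg_def)
  obtain g' where g': "g' \<in> borel_wug M p u" "AE x in M. g' x = gu x"
    by (rule borel_wug_majorant[OF M gu])
  \<comment> \<open>With \<open>g\<close> supported in the annulus, the integral over the whole
    space delivered by \<open>poincare_borel_wug\<close> is one over the annulus only.\<close>
  define g where "g x = g' x * indicator (- ball x0 r) x * indicator (- (- ball x0 R)) x" for x
  let ?A = "ball x0 R - ball x0 r"
  have A: "?A \<in> sets M" using mms_ball[OF M] by auto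
  have p0: "0 < p" using p by simp
  have g: "g \<in> borel_wug M p u"
    unfolding g_def
    by (intro borel_wug_restrict[where c=0, OF M p0] borel_wug_restrict[where c=1, OF M p0] g')
      (auto simp: u0 u1)
  have I: "ennreal c \<le> ennreal (C * (2 * R)) * (\<integral>\<^sup>+y\<in>ball x0 (\<Lambda> * (2 * R)). h y \<partial>M)"
    if h: "upper_gradient u h" for h
  proof -
    have "(\<integral>\<^sup>+y. e2ennreal \<bar>u y\<bar> \<partial>M) \<le> (\<integral>\<^sup>+y. indicator (ball x0 R) y \<partial>M)"
    proof (intro nn_integral_mono)
      fix x
      show "e2ennreal \<bar>u x\<bar> \<le> indicator (ball x0 R) x"
      proof (cases "x \<in> ball x0 R")
        case True
        have "0 \<le> (indicator (ball x0 r) x :: ereal)" by (simp add: indicator_def)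
        then have "0 \<le> u x" "u x \<le> 1" using uR[OF True] by (auto intro: order_trans)
        then have "e2ennreal \<bar>u x\<bar> \<le> e2ennreal 1" by (intro e2ennreal_mono) simp
        then show ?thesis using True by (simp add: e2ennreal_01)
      qed (simp add: u0 e2ennreal_01)
    qed
    also have "\<dots> < \<infinity>"
      using mms_measure_ball(1)[OF M, of R x0] r mms_ball[OF M, of x0 R] by simp
    finally have ui: "(\<integral>\<^sup>+y. e2ennreal \<bar>u y\<bar> \<partial>M) < \<infinity>" .
    \<comment> \<open>The hypotheses on \<open>s\<close> place \<open>ball y s\<close> in the shell
      between the radii \<open>R\<close> and \<open>2 * R\<close>, where
      \<open>u = 0\<close>.\<close>
    have S: "R \<le> dist x0 z" "dist x0 z < 2 * R" if "z \<in> ball y s" for z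
      using that s dist_triangle[of x0 y z] dist_triangle[of x0 z y] by (auto simp: dist_commute)
    have "ennreal c \<le> (\<integral>\<^sup>+z\<in>ball x0 (2 * R). e2ennreal \<bar>u z - ereal (mean_value M (ball x0 (2 * R)) u)\<bar> \<partial>M)"
    proof (rule oscillation_ge[of "ball x0 r" M "ball y s"])
      show "ball x0 r \<inter> ball y s = {}" using S(1) r by fastforce
      show "ball x0 r \<subseteq> ball x0 (2 * R)" using r by (intro subset_ball) simp
      show "ball y s \<subseteq> ball x0 (2 * R)" using S(2) by auto
      show "u x = 0" if "x \<in> ball y s" for x using S(1)[OF that] by (intro u0) simp
      show "ennreal c \<le> emeasure M (ball x0 r)" "ennreal c \<le> emeasure M (ball y s)"
        using c r s by (simp_all add: mms_measure_ball[OF M] ennreal_leI)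
    qed (auto simp: mms_ball[OF M] u1)
    also have "\<dots> \<le> ennreal (C * (2 * R)) * (\<integral>\<^sup>+y\<in>ball x0 (\<Lambda> * (2 * R)). h y \<partial>M)"
      using P(1)[unfolded poincare_bound_def, rule_format, OF _ um ui h, of "2 * R" x0] r by simp
    finally show ?thesis .
  qed
  have "0 < \<Lambda> * (2 * R)" using P r by simp
  have "ennreal c \<le> ennreal (C * (2 * R)) * (\<integral>\<^sup>+x. g x \<partial>M)"
    by (rule poincare_borel_wug[OF M p g \<open>0 < \<Lambda> * (2 * R)\<close>]) (rule I)
  also have "(\<integral>\<^sup>+x. g x \<partial>M) = (\<integral>\<^sup>+x\<in>?A. gu x \<partial>M)"
    by (intro nn_integral_cong_AE) (use g'(2) in eventually_elim, simp add: g_def split: split_indicator)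
  finally have "ennreal (c / (C * (2 * R))) \<le> (\<integral>\<^sup>+x\<in>?A. gu x \<partial>M)"
  proof (cases "\<integral>\<^sup>+x\<in>?A. gu x \<partial>M")
    case (real Y)
    assume "ennreal c \<le> ennreal (C * (2 * R)) * (\<integral>\<^sup>+x\<in>?A. gu x \<partial>M)"
    then have "ennreal c \<le> ennreal (C * (2 * R) * Y)"
      unfolding real using P r real by (subst ennreal_mult) auto
    then have "c \<le> C * (2 * R) * Y" using P r real by (subst (asm) ennreal_le_iff) auto
    then have "c / (C * (2 * R)) \<le> Y" using P r by (subst pos_divide_le_eq) (auto simp: mult_ac)
    then show ?thesis unfolding real by (rule ennreal_leI)
  qed simp
  then have "ennreal ((c / (C * (2 * R))) powr p * \<alpha> powr (1 - p)) \<le> (\<integral>\<^sup>+x\<in>?A. enn_powr (gu x) p \<partial>M)"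
  proof (intro nn_integral_enn_powr_ge gum A p)
    have "emeasure M ?A \<le> emeasure M (ball x0 R)"
      using mms_ball[OF M] by (intro emeasure_mono) auto
    then have "emeasure M ?A \<noteq> \<infinity>"
      using mms_measure_ball(1)[OF M, of R x0] r by (auto simp: top_unique)
    then have "emeasure M ?A = ennreal (measure M ?A)" by (intro emeasure_eq_ennreal_measure) auto
    then show "emeasure M ?A \<le> ennreal \<alpha>" using \<alpha> by (simp add: ennreal_leI)
  qed (use \<alpha> c P r in auto)
  also have "\<dots> \<le> (\<integral>\<^sup>+x\<in>ball x0 R. enn_powr (gu x) p \<partial>M)"
    by (intro nn_integral_mono) (auto split: split_indicator)
  finally show "ennreal ((c / (C * (2 * R))) powr p * \<alpha> powr (1 - p))
    \<le> (\<integral>\<^sup>+x\<in>ball x0 R. enn_powr (minimal_weak_upper_gradient M p u x) p \<partial>M)"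
    unfolding gu_def .
qed

text \<open>If all points were within \<open>s\<close> of \<open>x0\<close>, the diameter would be
  at most \<open>2 * s < 3 * R\<close>.\<close>

lemma ediam_far_point:
  fixes x0 :: "'a::metric_space"
  assumes "ennreal R \<le> ediam (UNIV :: 'a set) / 3" "0 < s" "s < 3 / 2 * R"
  obtains z where "s \<le> dist x0 z"
proof (rule ccontr)
  assume "\<not> thesis"
  then have near: "dist x0 z < s" for z using that by (meson not_le)
  have "ediam (UNIV :: 'a set) \<le> ennreal (2 * s)"
    unfolding ediam_def
  proof (intro SUP_least, clarify)
    fix y z :: 'a
    have "dist y z \<le> dist x0 y + dist x0 z" by (metis dist_commute dist_triangle)
    then show "ennreal (dist y z) \<le> ennreal (2 * s)"
      using near[of y] near[of z] by (intro ennreal_leI) simp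
  qed
  then have "ediam (UNIV :: 'a set) / 3 \<le> ennreal (2 * s) / 3"
    by (rule divide_right_mono_ennreal)
  also have "\<dots> = ennreal (2 * s / 3)"
    using assms divide_ennreal[of "2 * s" 3] by simp
  finally have "ennreal R \<le> ennreal (2 * s / 3)" using assms(1) by simp
  then show False using assms by (simp add: ennreal_le_iff)
qed

theorem theorem1p3:
  fixes M :: "'a::metric_space measure" and p :: real
  assumes "metric_measure_space M"
    and "1 \<le> p"
    and "poincare_1 M"
    and "annular_decay_1 M"
  shows "\<exists>C::real. C \<ge> 1 \<and>
    (\<forall>(x0::'a) (r::real) (R::real).
       0 < R / 2 \<and> R / 2 \<le> r \<and> r < R \<and> ennreal R \<le> ediam (UNIV :: 'a set) / 3 \<longrightarrow>
       ennreal (1 / C * (1 - r / R) powr (1 - p) * (measure M (ball x0 R) / R powr p))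
         \<le> var_cap M p (ball x0 r) (ball x0 R) \<and>
       var_cap M p (ball x0 r) (ball x0 R)
         \<le> ennreal (C * (1 - r / R) powr (1 - p) * (measure M (ball x0 R) / R powr p)))"
proof -
  note M = assms(1) and p = assms(2)
  obtain A where A: "1 \<le> A" "\<And>x r R. 0 < r \<Longrightarrow> r < R \<Longrightarrow>
    measure M (ball x R - ball x r) \<le> A * (1 - r / R) * measure M (ball x R)"
    using annular_decay_1E[OF assms(4)] by blast
  \<comment> \<open>The factor \<open>1/20\<close> serves both balls: it takes \<open>4 * R\<close>
    to the radius \<open>1/5 * R\<close> of the ball around \<open>y\<close>, and \<open>R\<close>
    to a radius below \<open>r\<close>.\<close>
  obtain D where D: "1 \<le> D" "\<And>x R. 0 < R \<Longrightarrow> measure M (ball x R) \<le> D * measure M (ball x (1/20 * R))"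
    using annular_decay_doubling[OF M assms(4), of "1/20"] by auto
  obtain C \<Lambda> where C: "0 < C" "1 \<le> \<Lambda>" "poincare_bound M C \<Lambda>"
    by (rule poincare_1E[OF M assms(3)])
  \<comment> \<open>This is the constant that results from inserting \<open>c = \<mu> / D\<close>
    and \<open>\<alpha> = A * t * \<mu>\<close> into \<open>var_cap_ball_ge\<close>.\<close>
  define K where "K = (2 * C * D) powr p * A powr (p - 1)"
  have K: "0 < K" using C A D by (simp add: K_def)
  show ?thesis
  proof (intro exI[of _ "max A K"] conjI allI impI)
    show "1 \<le> max A K" using A by simp
    fix x0 :: 'a and r R :: real
    assume "0 < R / 2 \<and> R / 2 \<le> r \<and> r < R \<and> ennreal R \<le> ediam (UNIV :: 'a set) / 3"
    then have R: "0 < R" "R / 2 \<le> r" "0 < r" "r < R" and diam: "ennreal R \<le> ediam (UNIV :: 'a set) / 3"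
      by auto
    define \<mu> where "\<mu> = measure M (ball x0 R)"
    have \<mu>: "0 < \<mu>" unfolding \<mu>_def by (rule mms_measure_ball[OF M R(1)])
    define t where "t = 1 - r / R"
    have t: "0 < t" and Rt: "R - r = R * t" using R by (auto simp: t_def field_simps)
    have mono: "measure M (ball x a) \<le> measure M (ball y b)"
      if "ball x a \<subseteq> ball y b" "0 < b" for x y a b
      using that by (intro measure_mono_fmeasurable mms_ball[OF M] mms_fmeasurable_ball[OF M])
    have "(1 / (R - r)) powr p * measure M (ball x0 R - ball x0 r) \<le> (1 / (R - r)) powr p * (A * t * \<mu>)"
      using A(2)[OF R(3,4)] by (intro mult_left_mono) (auto simp: t_def \<mu>_def)
    \<comment> \<open>Since \<open>R - r = R * t\<close>, the gradient contributes \<open>t\<close>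
      to the power \<open>-p\<close>, and the measure of the annulus one factor
      \<open>t\<close>.\<close>
    also have "\<dots> = A * t powr (1 - p) * (\<mu> / R powr p)"
      using R t by (simp add: Rt powr_divide powr_mult powr_diff)
    also have "\<dots> \<le> max A K * t powr (1 - p) * (\<mu> / R powr p)"
      using \<mu> by (intro mult_right_mono) auto
    finally show "var_cap M p (ball x0 r) (ball x0 R) \<le>
        ennreal (max A K * (1 - r / R) powr (1 - p) * (measure M (ball x0 R) / R powr p))"
      using var_cap_ball_le[OF M p R(3,4), of x0] unfolding \<mu>_def t_def
      by (meson ennreal_leI order_trans)
    \<comment> \<open>Any factor below \<open>3/2\<close> is allowed by the diameter bound; nothing
      limits the distance of \<open>z\<close> from above.\<close>
    obtain z where z: "13/10 * R \<le> dist x0 z"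
      by (rule ediam_far_point[OF diam, of "13/10 * R" x0]) (use R in auto)
    \<comment> \<open>With radius \<open>1/5 * R\<close> around \<open>y\<close>, the lower bound
      \<open>6/5 * R\<close> keeps the ball off \<open>B_R\<close> and the upper bound
      \<open>13/10 * R\<close> keeps it within \<open>2 * R\<close> of \<open>x0\<close>.\<close>
    obtain y where y: "6/5 * R \<le> dist x0 y" "dist x0 y < 13/10 * R"
      by (rule poincare_shell_nonempty[OF M assms(3) _ _ z, of "6/5 * R"]) (use R in auto)
    define c where "c = \<mu> / D"
    have c: "0 < c" using \<mu> D by (simp add: c_def)
    have c1: "c \<le> measure M (ball x0 r)"
    proof -
      have "\<mu> \<le> D * measure M (ball x0 (1/20 * R))" unfolding \<mu>_def by (rule D(2)[OF R(1)])
      also have "\<dots> \<le> D * measure M (ball x0 r)"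
        using D R by (intro mult_left_mono mono subset_ball) auto
      finally show ?thesis using D by (simp add: c_def pos_divide_le_eq mult.commute)
    qed
    have c2: "c \<le> measure M (ball y (1/5 * R))"
    proof -
      have "ball x0 R \<subseteq> ball y (4 * R)"
      proof
        fix w assume "w \<in> ball x0 R"
        then show "w \<in> ball y (4 * R)"
          using y R dist_triangle[of y w x0] by (auto simp: dist_commute)
      qed
      then have "\<mu> \<le> measure M (ball y (4 * R))" unfolding \<mu>_def using R by (intro mono) auto
      also have "\<dots> \<le> D * measure M (ball y (1/20 * (4 * R)))" using R by (intro D(2)) simp
      finally show ?thesis using D by (simp add: c_def pos_divide_le_eq mult.commute)
    qed
    have lower: "ennreal ((c / (C * (2 * R))) powr p * (A * t * \<mu>) powr (1 - p)) \<le> var_cap M p (ball x0 r) (ball x0 R)"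
    proof (rule var_cap_ball_ge[OF M p C(3,1,2) R(3,4) _ _ _ c c1 c2])
      show "measure M (ball x0 R - ball x0 r) \<le> A * t * \<mu>"
        unfolding t_def \<mu>_def by (rule A(2)[OF R(3,4)])
    qed (use R y A t \<mu> in auto)
    have eq: "(c / (C * (2 * R))) powr p * (A * t * \<mu>) powr (1 - p)
        = 1 / K * t powr (1 - p) * (\<mu> / R powr p)"
      using A C D R t \<mu>
      by (simp add: c_def K_def powr_divide powr_mult powr_diff mult_ac)
    have le: "1 / max A K * t powr (1 - p) * (\<mu> / R powr p) \<le> 1 / K * t powr (1 - p) * (\<mu> / R powr p)"
      using \<mu> K by (intro mult_right_mono divide_left_mono) auto
    from order_trans[OF ennreal_leI[OF le] lower[unfolded eq]]
    show "ennreal (1 / max A K * (1 - r / R) powr (1 - p) * (measure M (ball x0 R) / R powr p))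
         \<le> var_cap M p (ball x0 r) (ball x0 R)"
      unfolding \<mu>_def t_def .
  qed
qed

end
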